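(* Let $d\ge1$ and $2\le p<\infty$. There is a constant $C>0$ (depending only on $p$ and $d$) such that for every $f\in L^1(\mathbb{R}^d)$, $$\int_{\mathbb{R}^d}|\hat f(\xi)|^p\,d\xi\le C\int_{\mathbb{R}^d}|f(x)|^p\left(\prod_{k=1}^d|x_k|\right)^{p-2}\,dx,$$ where both sides are understood as elements of $[0,\infty]$.
   Context: For $f\in L^1(\mathbb{R}^d)$, the Fourier transform is $\hat f(\xi)=\int_{\mathbb{R}^d}f(x)e^{-2\pi i x\cdot\xi}\,dx$. Points of $\mathbb{R}^d$ are written $x=(x_1,\ldots,x_d)$. *)

theory Defs
  imports "HOL-Analysis.Analysis"
begin

definition fourier_transform :: "(real ^ 'n \<Rightarrow> complex) \<Rightarrow> real ^ 'n \<Rightarrow> complex" where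
  "fourier_transform f \<xi> =
     (\<integral>x. f x * exp (- 2 * complex_of_real pi * \<i> * complex_of_real (x \<bullet> \<xi>)) \<partial>lebesgue)"

end

theory Submission
  imports Defs "HOL-Probability.Characteristic_Functions" "HOL-Real_Asymp.Real_Asymp"
begin

text \<open>
  In dimension one and for p > 2, let N(t) be the integral of |f| over |x| < t. At level l, cut f
  into its restrictions to N(|x|) <= l/2 and to N(|x|) > l/2. The transform of the first piece is at
  most l/2 in absolute value, and the second piece is handled by Chebyshev and Plancherel; integrating
  over l bounds the left-hand side by a multiple of the integral of |f|^2 N(|x|)^(p-2). Pointwise this
  integrand is at most |f|^p |x|^(p-2) + N(|x|)^p |x|^(-2), and the second term is controlled by a
  weighted Hardy inequality. Only the inequality half of Plancherel is needed, and Gaussian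
  damping gives it directly on integrable functions.

  In dimension d, the one-dimensional inequality is applied in one variable at a time, to the
  partially transformed function: the weights in the remaining variables are constants, and partial
  Fourier transforms of an integrable function are integrable on every slice.
\<close>

subsection \<open>The Plancherel inequality\<close>

text \<open>A piece of \<open>f\<close> has a uniformly small transform as soon as its L^1 norm is
  small, whatever its height. This is why the cut is made by accumulated mass and not by the size of
  |f|. Exchanging the integrals over the level l and over x leaves the integral of l^(p-3) from 0 to
  2 N(|x|). It converges at 0 only for p > 2 and costs a factor 1/(p-2), so p = 2 is read off from
  Plancherel separately.

  Nothing makes the right-hand side finite, and \<open>f\<close> may lie neither in L^2 nor in L^p.
  The argument therefore avoids density and duality: integrability of \<open>f\<close> alone
  justifies the transforms and the uses of Fubini, and all estimates are inequalities in
  [0,\<infinity>], where the exchange of integrals is Tonelli.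

  The passage to dimension d works on products of different spaces, so the inequality is phrased for
  an arbitrary measure, kernel and weight. Constants multiply under products, which gives C^d from
  the one-dimensional C.\<close>

lemma borel_measurable_cis [measurable]: "cis \<in> borel_measurable borel"
  by (intro borel_measurable_continuous_onI continuous_intros)

text \<open>Up to normalisation this is the characteristic function of the standard normal law at
  \<open>s * a\<close>, rescaled by the substitution \<xi> = s u.\<close>

lemma gaussian_fourier_integral:
  fixes s a :: real
  assumes s: "s > 0"
  shows "(\<integral>\<xi>. complex_of_real (exp (- \<xi>\<^sup>2 / (2 * s\<^sup>2))) * cis (a * \<xi>) \<partial>lborel)
    = complex_of_real (sqrt (2 * pi) * s * exp (- (s * a)\<^sup>2 / 2))"
proof -
  have "complex_of_real (exp (- (s * a)\<^sup>2 / 2)) = char std_normal_distribution (s * a)"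
    by (simp add: char_std_normal_distribution)
  also have "\<dots> = (\<integral>u. std_normal_density u *\<^sub>R iexp (s * a * u) \<partial>lborel)"
    unfolding char_def by (subst integral_density) auto
  also have "\<dots> = (\<integral>u. complex_of_real (1 / sqrt (2 * pi)) *
      (complex_of_real (exp (- (s * u)\<^sup>2 / (2 * s\<^sup>2))) * cis (a * (s * u))) \<partial>lborel)"
    using s by (intro Bochner_Integration.integral_cong)
      (auto simp: std_normal_density_def cis_conv_exp scaleR_conv_of_real power_mult_distrib mult_ac)
  also have "\<dots> = complex_of_real (1 / sqrt (2 * pi)) *
      (\<integral>u. complex_of_real (exp (- (s * u)\<^sup>2 / (2 * s\<^sup>2))) * cis (a * (s * u)) \<partial>lborel)"
    by (rule integral_mult_right_zero)
  finally have *: "(\<integral>u. complex_of_real (exp (- (s * u)\<^sup>2 / (2 * s\<^sup>2))) * cis (a * (s * u)) \<partial>lborel)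
     = complex_of_real (sqrt (2 * pi) * exp (- (s * a)\<^sup>2 / 2))"
    by (simp add: field_simps)
  show ?thesis
    using s * by (subst lborel_integral_real_affine[where c = s and t = 0])
      (auto simp: scaleR_conv_of_real)
qed

text \<open>The integrand is a multiple of the normal density with mean \<open>c\<close> and
  deviation \<open>1 / a\<close>. With \<open>a = 2 * pi * s\<close> it gives the total mass of the
  smoothing kernel in the damped Plancherel inequality.\<close>

lemma nn_integral_exp_square:
  fixes a c :: real
  assumes "a > 0"
  shows "(\<integral>\<^sup>+y. ennreal (exp (- (a * (c - y))\<^sup>2 / 2)) \<partial>lborel) = ennreal (sqrt (2 * pi) / a)"
proof -
  have eq: "exp (- (a * (c - y))\<^sup>2 / 2) = sqrt (2 * pi) / a * normal_density c (1 / a) y" for y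
    using assms by (simp add: normal_density_def real_sqrt_mult real_sqrt_divide power_mult_distrib
      power2_commute[of c y] power_divide mult_ac)
  show ?thesis unfolding eq
    using assms by (subst ennreal_mult)
      (auto simp: nn_integral_cmult nn_integral_eq_integral ennreal_mult[symmetric])
qed

lemma integrable_gaussian:
  fixes s :: real
  assumes "s > 0"
  shows "integrable lborel (\<lambda>\<xi>. exp (- \<xi>\<^sup>2 / (2 * s\<^sup>2)))"
proof -
  have eq: "exp (- \<xi>\<^sup>2 / (2 * s\<^sup>2)) = sqrt (2 * pi * s\<^sup>2) * normal_density 0 s \<xi>" for \<xi>
    using assms by (simp add: normal_density_def)
  show ?thesis unfolding eq using assms by simp
qed

lemma (in pair_sigma_finite)
  fixes a :: "'a \<Rightarrow> complex" and b :: "'b \<Rightarrow> complex"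
  assumes a: "integrable M1 a" and b: "integrable M2 b"
  shows integrable_tensor: "integrable (M1 \<Otimes>\<^sub>M M2) (\<lambda>z. a (fst z) * b (snd z))"
    and integral_tensor: "(\<integral>z. a (fst z) * b (snd z) \<partial>(M1 \<Otimes>\<^sub>M M2)) = integral\<^sup>L M1 a * integral\<^sup>L M2 b"
proof -
  note [measurable] = borel_measurable_integrable[OF a] borel_measurable_integrable[OF b]
  show *: "integrable (M1 \<Otimes>\<^sub>M M2) (\<lambda>z. a (fst z) * b (snd z))"
    using a b by (intro Fubini_integrable) (auto simp: norm_mult)
  show "(\<integral>z. a (fst z) * b (snd z) \<partial>(M1 \<Otimes>\<^sub>M M2)) = integral\<^sup>L M1 a * integral\<^sup>L M2 b"
    by (subst integral_fst'[OF *, symmetric]) simp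
qed

definition fourier_kernel :: "real \<Rightarrow> real \<Rightarrow> complex" where
  "fourier_kernel x \<xi> = cis (- 2 * pi * (x * \<xi>))"

lemma norm_fourier_kernel [simp]: "cmod (fourier_kernel x \<xi>) = 1"
  by (simp add: fourier_kernel_def)

lemma measurable_fourier_kernel [measurable]:
  "(\<lambda>z. fourier_kernel (fst z) (snd z)) \<in> borel_measurable (borel \<Otimes>\<^sub>M borel)"
  unfolding fourier_kernel_def by measurable

lemma integrable_mult_unimodular:
  fixes f e :: "'a \<Rightarrow> complex"
  assumes f: "integrable M f" and [measurable]: "e \<in> borel_measurable M" and "\<And>x. cmod (e x) \<le> 1"
  shows "integrable M (\<lambda>x. f x * e x)"
proof (rule Bochner_Integration.integrable_bound[OF f])
  note [measurable] = borel_measurable_integrable[OF f]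
  show "(\<lambda>x. f x * e x) \<in> borel_measurable M" by measurable
  show "AE x in M. cmod (f x * e x) \<le> cmod (f x)"
    using assms(3) by (auto simp: norm_mult mult_left_le)
qed

text \<open>Write |F|^2 as a double integral of f(x) cnj(f(y)) against exponentials and integrate in
  \<xi> first. The Gaussian turns into its transform evaluated at y - x, a nonnegative kernel of
  total mass 1 in either variable, and a kernel of this kind has norm at most 1 on L^2 (Schur test).
  The damping makes the triple integral absolutely convergent for integrable
  \<open>f\<close>.\<close>

lemma plancherel_damped:
  fixes f :: "real \<Rightarrow> complex" and s :: real
  assumes f: "integrable lborel f" and s: "s > 0"
  shows "(\<integral>\<^sup>+\<xi>. ennreal (exp (- \<xi>\<^sup>2 / (2 * s\<^sup>2)) * (cmod (\<integral>x. f x * fourier_kernel x \<xi> \<partial>lborel))\<^sup>2) \<partial>lborel)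
    \<le> (\<integral>\<^sup>+x. ennreal ((cmod (f x))\<^sup>2) \<partial>lborel)"
proof -
  note [measurable] = borel_measurable_integrable[OF f]
  define F where "F \<xi> = (\<integral>x. f x * fourier_kernel x \<xi> \<partial>lborel)" for \<xi>
  define g where "g \<xi> = exp (- \<xi>\<^sup>2 / (2 * s\<^sup>2))" for \<xi> :: real
  \<comment> \<open>The Fourier transform of \<open>g\<close>: the centred normal density of
    deviation 1/(2 pi s). The integrals over \<open>G\<close> below confirm that its mass is exactly
    1, which is why no constant is lost.\<close>
  define G where "G t = sqrt (2 * pi) * s * exp (- (2 * pi * s * t)\<^sup>2 / 2)" for t :: real
  define H where "H z = f (fst z) * cnj (f (snd z))" for z :: "real \<times> real"
  define e where "e z \<xi> = cis (2 * pi * (snd z - fst z) * \<xi>)" for z :: "real \<times> real" and \<xi>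
  have G_nonneg: "G t \<ge> 0" for t using s by (simp add: G_def)
  have [measurable]: "g \<in> borel_measurable borel" "G \<in> borel_measurable borel"
    unfolding g_def G_def by measurable
  have int_g: "integrable lborel (\<lambda>\<xi>. complex_of_real (g \<xi>))"
    using integrable_gaussian[OF s] unfolding g_def by simp
  have int_H: "integrable (lborel \<Otimes>\<^sub>M lborel) H"
    unfolding H_def using f by (intro lborel_pair.integrable_tensor) auto
  note [measurable] = borel_measurable_integrable[OF int_H]
  interpret P: pair_sigma_finite "lborel \<Otimes>\<^sub>M lborel :: (real \<times> real) measure" "lborel :: real measure"
    by (intro pair_sigma_finite.intro lborel_pair.P.sigma_finite_measure_axioms lborel.sigma_finite_measure_axioms)
  have G_int: "(\<integral>\<^sup>+x. ennreal (G (y - x)) \<partial>lborel) = 1" for y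
  proof -
    have "(\<integral>\<^sup>+x. ennreal (G (y - x)) \<partial>lborel) = ennreal (sqrt (2 * pi) * s) * ennreal (sqrt (2 * pi) / (2 * pi * s))"
      using s unfolding G_def
      by (subst nn_integral_exp_square[symmetric, where c = y]) (auto simp: ennreal_mult nn_integral_cmult)
    also have "\<dots> = 1"
      using s by (simp add: ennreal_mult[symmetric])
    finally show ?thesis .
  qed
  have G_int': "(\<integral>\<^sup>+y. ennreal (G (y - x)) \<partial>lborel) = 1" for x
    using G_int[of x] by (simp add: G_def power2_commute right_diff_distrib)
  \<comment> \<open>Integrated over \<xi> this gives \<open>H\<close> times the kernel
    \<open>G\<close>; integrated over the plane it gives the damped |F|^2. Comparing the two orders
    is the whole identity.\<close>
  define K where "K z \<xi> = H z * complex_of_real (g \<xi>) * e z \<xi>" for z \<xi>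
  have int_K: "integrable ((lborel \<Otimes>\<^sub>M lborel) \<Otimes>\<^sub>M lborel) (case_prod K)"
    unfolding K_def case_prod_beta e_def
    by (intro integrable_mult_unimodular P.integrable_tensor int_H int_g) auto
  have inner: "(\<integral>\<xi>. K z \<xi> \<partial>lborel) = H z * complex_of_real (G (snd z - fst z))" for z
  proof -
    have "G (snd z - fst z) = sqrt (2 * pi) * s * exp (- (s * (2 * pi * (snd z - fst z)))\<^sup>2 / 2)"
      by (simp add: G_def mult_ac)
    then show ?thesis
      using gaussian_fourier_integral[OF s, of "2 * pi * (snd z - fst z)"]
      by (simp add: K_def e_def g_def mult.assoc)
  qed
  \<comment> \<open>For a fixed frequency the exponential in y - x is the kernel at x times the
    conjugate kernel at y, so the double integral splits into F times its conjugate.\<close>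
  have outer: "(\<integral>z. K z \<xi> \<partial>(lborel \<Otimes>\<^sub>M lborel)) = complex_of_real (g \<xi> * (cmod (F \<xi>))\<^sup>2)" for \<xi>
  proof -
    have i: "integrable lborel (\<lambda>x. f x * fourier_kernel x \<xi>)"
      unfolding fourier_kernel_def by (intro integrable_mult_unimodular f) auto
    have "(\<integral>z. K z \<xi> \<partial>(lborel \<Otimes>\<^sub>M lborel)) = (\<integral>z. complex_of_real (g \<xi>) *
        ((f (fst z) * fourier_kernel (fst z) \<xi>) * cnj (f (snd z) * fourier_kernel (snd z) \<xi>)) \<partial>(lborel \<Otimes>\<^sub>M lborel))"
      by (intro Bochner_Integration.integral_cong)
        (auto simp: K_def H_def e_def fourier_kernel_def cis_cnj cis_mult algebra_simps)
    also have "\<dots> = complex_of_real (g \<xi>) * (F \<xi> * cnj (F \<xi>))"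
      using lborel_pair.integral_tensor[OF i integrable_cnj[OF i]]
      by (simp add: F_def integral_cnj del: complex_cnj_mult)
    finally show ?thesis by (simp only: of_real_mult complex_norm_square)
  qed
  have int_F: "integrable lborel (\<lambda>\<xi>. g \<xi> * (cmod (F \<xi>))\<^sup>2)"
    using P.integrable_snd[OF int_K] unfolding outer of_real_mult[symmetric] by (subst (asm) complex_of_real_integrable_eq)
  have "complex_of_real (\<integral>\<xi>. g \<xi> * (cmod (F \<xi>))\<^sup>2 \<partial>lborel)
      = (\<integral>z. H z * complex_of_real (G (snd z - fst z)) \<partial>(lborel \<Otimes>\<^sub>M lborel))"
    using P.Fubini_integral[OF int_K] unfolding inner outer by (simp only: integral_complex_of_real)
  then have "\<bar>\<integral>\<xi>. g \<xi> * (cmod (F \<xi>))\<^sup>2 \<partial>lborel\<bar> = cmod \<dots>" 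
    by (metis norm_of_real)
  have "(\<integral>\<^sup>+\<xi>. ennreal (g \<xi> * (cmod (F \<xi>))\<^sup>2) \<partial>lborel) = ennreal (\<integral>\<xi>. g \<xi> * (cmod (F \<xi>))\<^sup>2 \<partial>lborel)"
    by (intro nn_integral_eq_integral int_F) (auto simp: g_def)
  also have "\<dots> \<le> ennreal (cmod (\<integral>z. H z * complex_of_real (G (snd z - fst z)) \<partial>(lborel \<Otimes>\<^sub>M lborel)))"
    using \<open>\<bar>_\<bar> = cmod _\<close> by (intro ennreal_leI) simp
  also have "\<dots> \<le> (\<integral>\<^sup>+z. ennreal (cmod (H z * complex_of_real (G (snd z - fst z)))) \<partial>(lborel \<Otimes>\<^sub>M lborel))"
    using P.integrable_fst[OF int_K] unfolding inner by (rule integral_norm_bound_ennreal)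
  also have "\<dots> \<le> (\<integral>\<^sup>+z. ennreal ((cmod (f (fst z)))\<^sup>2 / 2) * ennreal (G (snd z - fst z))
      + ennreal ((cmod (f (snd z)))\<^sup>2 / 2) * ennreal (G (snd z - fst z)) \<partial>(lborel \<Otimes>\<^sub>M lborel))"
  proof (intro nn_integral_mono)
    fix z :: "real \<times> real"
    \<comment> \<open>Arithmetic-geometric mean: each of the two terms depends on \<open>f\<close>
      through one variable only, so \<open>G\<close> can be integrated out in the other.\<close>
    have "cmod (f (fst z)) * cmod (f (snd z)) \<le> (cmod (f (fst z)))\<^sup>2 / 2 + (cmod (f (snd z)))\<^sup>2 / 2"
      using sum_squares_bound[of "cmod (f (fst z))" "cmod (f (snd z))"] by simp
    from mult_right_mono[OF this G_nonneg[of "snd z - fst z"]] show "ennreal (cmod (H z * complex_of_real (G (snd z - fst z))))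
      \<le> ennreal ((cmod (f (fst z)))\<^sup>2 / 2) * ennreal (G (snd z - fst z))
      + ennreal ((cmod (f (snd z)))\<^sup>2 / 2) * ennreal (G (snd z - fst z))"
      unfolding H_def using G_nonneg[of "snd z - fst z"]
      by (simp add: norm_mult ennreal_mult[symmetric] ennreal_plus[symmetric] distrib_right del: ennreal_plus)
  qed
  also have "\<dots> = (\<integral>\<^sup>+z. ennreal ((cmod (f (fst z)))\<^sup>2 / 2) * ennreal (G (snd z - fst z)) \<partial>(lborel \<Otimes>\<^sub>M lborel))
      + (\<integral>\<^sup>+z. ennreal ((cmod (f (snd z)))\<^sup>2 / 2) * ennreal (G (snd z - fst z)) \<partial>(lborel \<Otimes>\<^sub>M lborel))"
    by (intro nn_integral_add) auto
  also have "(\<integral>\<^sup>+z. ennreal ((cmod (f (fst z)))\<^sup>2 / 2) * ennreal (G (snd z - fst z)) \<partial>(lborel \<Otimes>\<^sub>M lborel))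
      = (\<integral>\<^sup>+x. ennreal ((cmod (f x))\<^sup>2 / 2) * (\<integral>\<^sup>+y. ennreal (G (y - x)) \<partial>lborel) \<partial>lborel)"
    by (subst lborel.nn_integral_fst[symmetric]) (auto simp: nn_integral_cmult)
  also have "(\<integral>\<^sup>+z. ennreal ((cmod (f (snd z)))\<^sup>2 / 2) * ennreal (G (snd z - fst z)) \<partial>(lborel \<Otimes>\<^sub>M lborel))
      = (\<integral>\<^sup>+y. ennreal ((cmod (f y))\<^sup>2 / 2) * (\<integral>\<^sup>+x. ennreal (G (y - x)) \<partial>lborel) \<partial>lborel)"
    by (subst lborel_pair.nn_integral_snd[symmetric]) (auto simp: nn_integral_cmult)
  also have "(\<integral>\<^sup>+x. ennreal ((cmod (f x))\<^sup>2 / 2) * (\<integral>\<^sup>+y. ennreal (G (y - x)) \<partial>lborel) \<partial>lborel)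
      + (\<integral>\<^sup>+y. ennreal ((cmod (f y))\<^sup>2 / 2) * (\<integral>\<^sup>+x. ennreal (G (y - x)) \<partial>lborel) \<partial>lborel)
     = (\<integral>\<^sup>+x. ennreal ((cmod (f x))\<^sup>2) \<partial>lborel)"
    unfolding G_int G_int' by (subst nn_integral_add[symmetric]) (auto simp: ennreal_plus[symmetric] simp del: ennreal_plus)
  finally show ?thesis unfolding g_def F_def .
qed

text \<open>The Gaussians of width \<open>Suc n\<close> tend to 1 pointwise and the damped bound is
  uniform in the width, so Fatou's lemma removes the damping.\<close>

lemma plancherel_le:
  fixes f :: "real \<Rightarrow> complex"
  assumes f: "integrable lborel f"
  shows "(\<integral>\<^sup>+\<xi>. ennreal ((cmod (\<integral>x. f x * fourier_kernel x \<xi> \<partial>lborel))\<^sup>2) \<partial>lborel)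
    \<le> (\<integral>\<^sup>+x. ennreal ((cmod (f x))\<^sup>2) \<partial>lborel)"
proof -
  note [measurable] = borel_measurable_integrable[OF f]
  define F where "F \<xi> = (\<integral>x. f x * fourier_kernel x \<xi> \<partial>lborel)" for \<xi>
  have [measurable]: "F \<in> borel_measurable borel"
    unfolding F_def fourier_kernel_def by measurable
  define u where "u n \<xi> = ennreal (exp (- \<xi>\<^sup>2 / (2 * (real (Suc n))\<^sup>2)) * (cmod (F \<xi>))\<^sup>2)" for n \<xi>
  have lim: "(\<lambda>n. u n \<xi>) \<longlonglongrightarrow> ennreal ((cmod (F \<xi>))\<^sup>2)" for \<xi>
  proof -
    have "(\<lambda>n. exp (- \<xi>\<^sup>2 / (2 * (real (Suc n))\<^sup>2))) \<longlonglongrightarrow> 1"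
      by real_asymp
    then have "(\<lambda>n. exp (- \<xi>\<^sup>2 / (2 * (real (Suc n))\<^sup>2)) * (cmod (F \<xi>))\<^sup>2) \<longlonglongrightarrow> 1 * (cmod (F \<xi>))\<^sup>2"
      by (intro tendsto_mult tendsto_const)
    then show ?thesis unfolding u_def by (intro tendsto_ennrealI) simp
  qed
  have "(\<integral>\<^sup>+\<xi>. ennreal ((cmod (F \<xi>))\<^sup>2) \<partial>lborel) = (\<integral>\<^sup>+\<xi>. liminf (\<lambda>n. u n \<xi>) \<partial>lborel)"
    by (intro nn_integral_cong) (metis lim lim_imp_Liminf sequentially_bot)
  also have "\<dots> \<le> liminf (\<lambda>n. \<integral>\<^sup>+\<xi>. u n \<xi> \<partial>lborel)"
    by (intro nn_integral_liminf) (auto simp: u_def)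
  also have "\<dots> \<le> liminf (\<lambda>n::nat. \<integral>\<^sup>+x. ennreal ((cmod (f x))\<^sup>2) \<partial>lborel)"
    unfolding u_def F_def by (intro Liminf_mono always_eventually allI plancherel_damped f) auto
  also have "\<dots> = (\<integral>\<^sup>+x. ennreal ((cmod (f x))\<^sup>2) \<partial>lborel)"
    by (simp add: Liminf_const)
  finally show ?thesis unfolding F_def .
qed

subsection \<open>Power weights and a weighted Jensen inequality\<close>

lemma nn_integral_powr_from_0:
  fixes a c :: real
  assumes "a > -1" "c \<ge> 0"
  shows "(\<integral>\<^sup>+x. ennreal (indicator {0..c} x * x powr a) \<partial>lborel) = ennreal (c powr (a + 1) / (a + 1))"
proof (intro nn_integral_has_integral_lborel)
  show "((\<lambda>x. indicator {0..c} x * x powr a) has_integral c powr (a + 1) / (a + 1)) UNIV"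
    using has_integral_powr_from_0[OF assms]
    by (subst (asm) has_integral_restrict_UNIV[symmetric])
      (simp add: indicator_def of_bool_def if_distrib if_distribR cong: if_cong)
qed auto

lemma nn_integral_powr_to_inf:
  fixes a c :: real
  assumes "a < -1" "c > 0"
  shows "(\<integral>\<^sup>+x. ennreal (indicator {c..} x * x powr a) \<partial>lborel) = ennreal (- (c powr (a + 1)) / (a + 1))"
proof (intro nn_integral_has_integral_lborel)
  show "((\<lambda>x. indicator {c..} x * x powr a) has_integral - (c powr (a + 1)) / (a + 1)) UNIV"
    using has_integral_powr_to_inf[OF assms]
    by (subst (asm) has_integral_restrict_UNIV[symmetric])
      (simp add: indicator_def of_bool_def if_distrib if_distribR cong: if_cong)
qed auto

lemma nn_integral_even:
  fixes g :: "real \<Rightarrow> ennreal"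
  assumes [measurable]: "g \<in> borel_measurable borel"
  shows "(\<integral>\<^sup>+x. g \<bar>x\<bar> \<partial>lborel) = 2 * (\<integral>\<^sup>+x. indicator {0..} x * g x \<partial>lborel)"
proof -
  have "(\<integral>\<^sup>+x. g \<bar>x\<bar> \<partial>lborel) = (\<integral>\<^sup>+x. indicator {0..} x * g x + indicator {0..} (- x) * g (- x) \<partial>lborel)"
  proof (intro nn_integral_cong_AE)
    show "AE x in lborel. g \<bar>x\<bar> = indicator {0..} x * g x + indicator {0..} (- x) * g (- x)"
      using AE_lborel_singleton[of "0::real"] by eventually_elim (auto simp: indicator_def)
  qed
  also have "\<dots> = (\<integral>\<^sup>+x. indicator {0..} x * g x \<partial>lborel) + (\<integral>\<^sup>+x. indicator {0..} (- x) * g (- x) \<partial>lborel)"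
    by (intro nn_integral_add) auto
  also have "(\<integral>\<^sup>+x. indicator {0..} (- x) * g (- x) \<partial>lborel) = (\<integral>\<^sup>+x. indicator {0..} x * g x \<partial>lborel)"
    by (subst (2) nn_integral_real_affine[where c = "-1" and t = 0]) auto
  finally show ?thesis by (simp add: mult_2)
qed

lemma nn_integral_abs_powr_near_0:
  fixes a r :: real
  assumes "a > -1" "r \<ge> 0"
  shows "(\<integral>\<^sup>+y. ennreal (indicator {y. \<bar>y\<bar> < r} y * \<bar>y\<bar> powr a) \<partial>lborel) = ennreal (2 * r powr (a + 1) / (a + 1))"
proof -
  have "(\<integral>\<^sup>+y. ennreal (indicator {y. \<bar>y\<bar> < r} y * \<bar>y\<bar> powr a) \<partial>lborel)
      = (\<integral>\<^sup>+y. ennreal (indicator {..<r} \<bar>y\<bar> * \<bar>y\<bar> powr a) \<partial>lborel)"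
    by (simp add: indicator_def)
  also have "\<dots> = 2 * (\<integral>\<^sup>+y. indicator {0..} y * ennreal (indicator {..<r} y * y powr a) \<partial>lborel)"
    by (rule nn_integral_even) simp
  also have "(\<integral>\<^sup>+y. indicator {0..} y * ennreal (indicator {..<r} y * y powr a) \<partial>lborel)
     = (\<integral>\<^sup>+x. ennreal (indicator {0..r} x * x powr a) \<partial>lborel)"
  proof (intro nn_integral_cong_AE)
    show "AE y in lborel. indicator {0..} y * ennreal (indicator {..<r} y * y powr a) = ennreal (indicator {0..r} y * y powr a)"
      using AE_lborel_singleton[of r] by eventually_elim (auto simp: indicator_def)
  qed
  also have "2 * \<dots> = ennreal (2 * r powr (a + 1) / (a + 1))"
    using assms by (simp add: nn_integral_powr_from_0 flip: ennreal_numeral ennreal_mult)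
  finally show ?thesis .
qed

lemma nn_integral_abs_powr_away_0:
  fixes a r :: real
  assumes "a < -1" "r > 0"
  shows "(\<integral>\<^sup>+y. ennreal (indicator {y. r < \<bar>y\<bar>} y * \<bar>y\<bar> powr a) \<partial>lborel) = ennreal (- 2 * r powr (a + 1) / (a + 1))"
proof -
  have "(\<integral>\<^sup>+y. ennreal (indicator {y. r < \<bar>y\<bar>} y * \<bar>y\<bar> powr a) \<partial>lborel)
      = (\<integral>\<^sup>+y. ennreal (indicator {r<..} \<bar>y\<bar> * \<bar>y\<bar> powr a) \<partial>lborel)"
    by (simp add: indicator_def)
  also have "\<dots> = 2 * (\<integral>\<^sup>+y. indicator {0..} y * ennreal (indicator {r<..} y * y powr a) \<partial>lborel)"
    by (rule nn_integral_even) simp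
  also have "(\<integral>\<^sup>+y. indicator {0..} y * ennreal (indicator {r<..} y * y powr a) \<partial>lborel)
     = (\<integral>\<^sup>+x. ennreal (indicator {r..} x * x powr a) \<partial>lborel)"
  proof (intro nn_integral_cong_AE)
    show "AE y in lborel. indicator {0..} y * ennreal (indicator {r<..} y * y powr a) = ennreal (indicator {r..} y * y powr a)"
      using AE_lborel_singleton[of r] by eventually_elim (use assms in \<open>auto simp: indicator_def\<close>)
  qed
  also have "2 * \<dots> = ennreal (- 2 * r powr (a + 1) / (a + 1))"
    using assms by (simp add: nn_integral_powr_to_inf divide_nonneg_neg divide_nonpos_neg flip: ennreal_numeral ennreal_mult)
  finally show ?thesis .
qed

text \<open>The graph of t^p lies above its tangent at t = m; take t = u/h and multiply by
  \<open>h\<close>. The contact point \<open>m\<close> stays free so that it can be optimised after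
  integration.\<close>

lemma young_weighted:
  fixes p m h u :: real
  assumes p: "p > 1" and "m \<ge> 0" "u \<ge> 0" "h > 0"
  shows "p * m powr (p - 1) * u \<le> u powr p * h powr (1 - p) + (p - 1) * m powr p * h"
proof -
  have "(u / h) * m powr (p - 1) \<le> (u / h) powr p / p + (m powr (p - 1)) powr (p / (p - 1)) / (p / (p - 1))"
    using assms by (intro Youngs_inequality) (auto simp: field_simps)
  also have "(m powr (p - 1)) powr (p / (p - 1)) = m powr p"
    using p by (simp add: powr_powr)
  finally have "p * h * ((u / h) * m powr (p - 1)) \<le> p * h * ((u / h) powr p / p + m powr p / (p / (p - 1)))"
    using assms by (intro mult_left_mono) auto
  also have "\<dots> = (u / h) powr p * h + (p - 1) * m powr p * h"
    using assms by (simp add: field_simps)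
  also have "(u / h) powr p * h = u powr p * h powr (1 - p)"
    using assms by (simp add: powr_divide powr_diff)
  finally show ?thesis using assms by (simp add: mult_ac)
qed

text \<open>Jensen's inequality for t^p and the quotient \<phi>/h under the measure with density
  \<open>h\<close>, obtained by integrating the tangent inequality. The support condition matters
  because \<open>0 powr (1 - p)\<close> is 0: mass of \<open>\<phi>\<close> sitting where
  \<open>h\<close> vanishes would be invisible on the right.\<close>

lemma weighted_jensen:
  fixes \<phi> h :: "'a \<Rightarrow> real" and p N H :: real
  assumes p: "p > 1" and [measurable]: "\<phi> \<in> borel_measurable M" "h \<in> borel_measurable M"
    and nonneg: "\<And>x. \<phi> x \<ge> 0" "\<And>x. h x \<ge> 0" "N \<ge> 0" and "H > 0"
    and supp: "AE x in M. h x = 0 \<longrightarrow> \<phi> x = 0"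
    and N: "(\<integral>\<^sup>+x. ennreal (\<phi> x) \<partial>M) = ennreal N" and H: "(\<integral>\<^sup>+x. ennreal (h x) \<partial>M) = ennreal H"
  shows "ennreal (N powr p) \<le> ennreal (H powr (p - 1)) * (\<integral>\<^sup>+x. ennreal (\<phi> x powr p * h x powr (1 - p)) \<partial>M)"
proof (cases "(\<integral>\<^sup>+x. ennreal (\<phi> x powr p * h x powr (1 - p)) \<partial>M) = top")
  case True
  then show ?thesis using \<open>H > 0\<close> by (simp add: ennreal_mult_top)
next
  case False
  then obtain J where J: "J \<ge> 0" "(\<integral>\<^sup>+x. ennreal (\<phi> x powr p * h x powr (1 - p)) \<partial>M) = ennreal J"
    by (cases "\<integral>\<^sup>+x. ennreal (\<phi> x powr p * h x powr (1 - p)) \<partial>M") auto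
  \<comment> \<open>The mean of \<phi>/h, hence the best contact point for the tangent: p m^(p-1) N
    equals p m^p H, and subtracting (p-1) m^p H leaves m^(p-1) N.\<close>
  define m where "m = N / H"
  have m: "m \<ge> 0" using assms by (simp add: m_def)
  have "ennreal (p * m powr (p - 1)) * ennreal N = (\<integral>\<^sup>+x. ennreal (p * m powr (p - 1)) * ennreal (\<phi> x) \<partial>M)"
    using N by (simp add: nn_integral_cmult)
  also have "\<dots> \<le> (\<integral>\<^sup>+x. ennreal (\<phi> x powr p * h x powr (1 - p)) + ennreal ((p - 1) * m powr p) * ennreal (h x) \<partial>M)"
  proof (intro nn_integral_mono_AE)
    show "AE x in M. ennreal (p * m powr (p - 1)) * ennreal (\<phi> x)
      \<le> ennreal (\<phi> x powr p * h x powr (1 - p)) + ennreal ((p - 1) * m powr p) * ennreal (h x)"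
      using supp
    proof eventually_elim
      case (elim x)
      show ?case
      proof (cases "h x = 0")
        case True
        then show ?thesis using elim by simp
      next
        case False
        then have "p * m powr (p - 1) * \<phi> x \<le> \<phi> x powr p * h x powr (1 - p) + (p - 1) * m powr p * h x"
          using nonneg(1,2)[of x] p m by (intro young_weighted) auto
        then show ?thesis
          using nonneg(1,2)[of x] p by (simp add: ennreal_mult[symmetric] ennreal_plus[symmetric] del: ennreal_plus)
      qed
    qed
  qed
  also have "\<dots> = ennreal J + ennreal ((p - 1) * m powr p) * ennreal H"
    using J H by (simp add: nn_integral_add nn_integral_cmult)
  finally have *: "p * m powr (p - 1) * N \<le> J + (p - 1) * m powr p * H"
    using p nonneg J \<open>H > 0\<close> by (simp add: ennreal_mult[symmetric] ennreal_plus[symmetric] del: ennreal_plus)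
  have "N powr p \<le> H powr (p - 1) * J"
  proof (cases "N = 0")
    case False
    then have "N > 0" using nonneg by simp
    then have "m > 0" using \<open>H > 0\<close> by (simp add: m_def)
    then have 1: "m powr p = m powr (p - 1) * m" by (simp add: powr_diff)
    have 2: "m * H = N" using \<open>H > 0\<close> by (simp add: m_def)
    have "m powr (p - 1) * N \<le> J"
      using * unfolding 1 by (simp add: mult.assoc 2 left_diff_distrib)
    then have "H powr (p - 1) * (m powr (p - 1) * N) \<le> H powr (p - 1) * J"
      by (intro mult_left_mono) auto
    also have "H powr (p - 1) * (m powr (p - 1) * N) = (m * H) powr (p - 1) * N"
      using \<open>H > 0\<close> \<open>m > 0\<close> by (simp add: powr_mult)
    also have "\<dots> = N powr p" unfolding 2 using \<open>N > 0\<close> by (simp add: powr_diff)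
    finally show ?thesis .
  qed (use J in auto)
  then show ?thesis unfolding J by (simp add: ennreal_mult[symmetric] J)
qed

subsection \<open>Splitting at a level of the central mass\<close>

text \<open>A Bochner integral, not a nonnegative one, so that the value is a real number to which
  \<open>powr\<close> applies.\<close>

definition central_mass :: "(real \<Rightarrow> complex) \<Rightarrow> real \<Rightarrow> real" where
  "central_mass f t = (\<integral>y. indicator {y. \<bar>y\<bar> < t} y * cmod (f y) \<partial>lborel)"

lemma central_mass_nonneg: "central_mass f t \<ge> 0"
  unfolding central_mass_def by (intro Bochner_Integration.integral_nonneg) auto

lemma integrable_central_mass:
  assumes "integrable lborel f"
  shows "integrable lborel (\<lambda>y::real. indicator {y. \<bar>y\<bar> < t} y * cmod (f y))"
  using integrable_mult_indicator[of "{y. \<bar>y\<bar> < t}" lborel "\<lambda>y. cmod (f y)"] assms by simp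

lemma nn_integral_central_mass:
  assumes "integrable lborel f"
  shows "(\<integral>\<^sup>+y. ennreal (indicator {y. \<bar>y\<bar> < t} y * cmod (f y)) \<partial>lborel) = ennreal (central_mass f t)"
  unfolding central_mass_def using assms
  by (intro nn_integral_eq_integral integrable_central_mass) auto

lemma measurable_central_mass [measurable]:
  assumes [measurable]: "f \<in> borel_measurable borel"
  shows "central_mass f \<in> borel_measurable borel"
proof -
  have [measurable]: "Measurable.pred (borel \<Otimes>\<^sub>M borel) (\<lambda>z::real \<times> real. \<bar>snd z\<bar> < fst z)"
    by measurable
  have "(\<lambda>t. \<integral>y. (if \<bar>y\<bar> < t then cmod (f y) else 0) \<partial>lborel) \<in> borel_measurable borel"
    by measurable
  then show ?thesis
    unfolding central_mass_def by (simp add: indicator_def of_bool_def if_distribR cong: if_cong)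
qed

lemma central_mass_mono:
  assumes "integrable lborel f" "s \<le> t"
  shows "central_mass f s \<le> central_mass f t"
  unfolding central_mass_def using assms
  by (intro integral_mono integrable_central_mass) (auto simp: indicator_def)

text \<open>The sublevel set is, up to two points, the ball of radius \<open>Sup S\<close> (or the whole line), which
  is exhausted by balls of central mass at most \<open>c\<close>.\<close>
lemma sublevel_central_mass:
  assumes f: "integrable lborel f" and c: "c \<ge> 0"
  shows "(\<integral>\<^sup>+y. ennreal (indicator {y. central_mass f \<bar>y\<bar> \<le> c} y * cmod (f y)) \<partial>lborel) \<le> ennreal c"
proof -
  note [measurable] = borel_measurable_integrable[OF f]
  define S where "S = {t. t \<ge> 0 \<and> central_mass f t \<le> c}"
  have "central_mass f 0 = 0" by (simp add: central_mass_def)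
  then have S0: "0 \<in> S" using c by (simp add: S_def)
  have below: "central_mass f t \<le> c" if "t \<le> s" "s \<in> S" for s t
    using central_mass_mono[OF f that(1)] that(2) by (simp add: S_def)
  have "\<exists>t :: nat \<Rightarrow> real. (\<forall>n. central_mass f (t n) \<le> c) \<and>
      (AE y in lborel. central_mass f \<bar>y\<bar> \<le> c \<longrightarrow> (\<forall>\<^sub>F n in sequentially. \<bar>y\<bar> < t n))"
  proof (cases "bdd_above S")
    case True
    define T where "T = Sup S"
    \<comment> \<open>Staying strictly below \<open>T\<close> avoids deciding whether the supremum
      is attained.\<close>
    have "central_mass f (T - 1 / real (Suc n)) \<le> c" for n
    proof -
      have "T - 1 / real (Suc n) < Sup S" by (simp add: T_def)
      then obtain s where "s \<in> S" "T - 1 / real (Suc n) < s"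
        using S0 True by (metis empty_iff less_cSup_iff)
      then show ?thesis by (intro below[of _ s]) auto
    qed
    moreover have "AE y in lborel. central_mass f \<bar>y\<bar> \<le> c \<longrightarrow> (\<forall>\<^sub>F n in sequentially. \<bar>y\<bar> < T - 1 / real (Suc n))"
      using AE_lborel_singleton[of T] AE_lborel_singleton[of "-T"]
    proof eventually_elim
      case (elim y)
      show ?case
      proof
        assume "central_mass f \<bar>y\<bar> \<le> c"
        then have "\<bar>y\<bar> \<in> S" by (simp add: S_def)
        then have "\<bar>y\<bar> \<le> T" unfolding T_def using True by (rule cSup_upper)
        then have *: "\<bar>y\<bar> < T" using elim by auto
        have "(\<lambda>n. T - 1 / real (Suc n)) \<longlonglongrightarrow> T" by real_asymp
        from order_tendstoD(1)[OF this *] show "\<forall>\<^sub>F n in sequentially. \<bar>y\<bar> < T - 1 / real (Suc n)" .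
      qed
    qed
    ultimately show ?thesis by (intro exI[of _ "\<lambda>n. T - 1 / real (Suc n)"]) auto
  next
    case False
    have "central_mass f (real n) \<le> c" for n
    proof -
      obtain s where "s \<in> S" "real n < s"
        using False unfolding bdd_above_def by (metis not_le)
      then show ?thesis by (intro below[of _ s]) auto
    qed
    moreover have "\<forall>\<^sub>F n in sequentially. \<bar>y\<bar> < real n" for y :: real
      using filterlim_real_sequentially by (auto simp: filterlim_at_top_dense)
    ultimately show ?thesis by (intro exI[of _ real]) auto
  qed
  \<comment> \<open>One sequence of radii now serves the bounded and the unbounded case, and Fatou's
    lemma carries the bound \<open>c\<close> from the balls to the sublevel set.\<close>
  then obtain t :: "nat \<Rightarrow> real" where t: "\<And>n. central_mass f (t n) \<le> c"
    and ev: "AE y in lborel. central_mass f \<bar>y\<bar> \<le> c \<longrightarrow> (\<forall>\<^sub>F n in sequentially. \<bar>y\<bar> < t n)"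
    by blast
  have "(\<integral>\<^sup>+y. ennreal (indicator {y. central_mass f \<bar>y\<bar> \<le> c} y * cmod (f y)) \<partial>lborel)
    \<le> (\<integral>\<^sup>+y. liminf (\<lambda>n. ennreal (indicator {y. \<bar>y\<bar> < t n} y * cmod (f y))) \<partial>lborel)"
  proof (intro nn_integral_mono_AE)
    show "AE y in lborel. ennreal (indicator {y. central_mass f \<bar>y\<bar> \<le> c} y * cmod (f y))
      \<le> liminf (\<lambda>n. ennreal (indicator {y. \<bar>y\<bar> < t n} y * cmod (f y)))"
      using ev
    proof eventually_elim
      case (elim y)
      show ?case
      proof (cases "central_mass f \<bar>y\<bar> \<le> c")
        case True
        then have "\<forall>\<^sub>F n in sequentially. \<bar>y\<bar> < t n" using elim by simp
        then have "\<forall>\<^sub>F n in sequentially. ennreal (indicator {y. central_mass f \<bar>y\<bar> \<le> c} y * cmod (f y))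
            \<le> ennreal (indicator {y. \<bar>y\<bar> < t n} y * cmod (f y))"
          by eventually_elim (simp add: True)
        then show ?thesis by (rule Liminf_bounded)
      qed simp
    qed
  qed
  also have "\<dots> \<le> liminf (\<lambda>n. \<integral>\<^sup>+y. ennreal (indicator {y. \<bar>y\<bar> < t n} y * cmod (f y)) \<partial>lborel)"
    by (intro nn_integral_liminf) auto
  also have "\<dots> \<le> liminf (\<lambda>n::nat. ennreal c)"
    unfolding nn_integral_central_mass[OF f]
    by (intro Liminf_mono always_eventually allI ennreal_leI t)
  finally show ?thesis by (simp add: Liminf_const)
qed

text \<open>Where the transform of \<open>f\<close> reaches \<open>l\<close>, the piece
  \<open>a\<close> accounts for at most half of it, so the transform of \<open>b\<close> is at least
  l/2 there. The factor 4/l^2 is the inverse square of this half level. The integral on the right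
  may be infinite, since \<open>b\<close> is only known to be integrable.\<close>

lemma weak_type_estimate:
  fixes f :: "real \<Rightarrow> complex"
  assumes f: "integrable lborel f" and l: "l > 0"
  shows "emeasure lborel {\<xi>. l \<le> cmod (\<integral>x. f x * fourier_kernel x \<xi> \<partial>lborel)}
    \<le> ennreal (4 / l\<^sup>2) * (\<integral>\<^sup>+x. ennreal (indicator {x. l / 2 < central_mass f \<bar>x\<bar>} x * (cmod (f x))\<^sup>2) \<partial>lborel)"
proof -
  note [measurable] = borel_measurable_integrable[OF f]
  define A where "A = {x. central_mass f \<bar>x\<bar> \<le> l / 2}"
  define a where "a x = indicator A x *\<^sub>R f x" for x
  define b where "b x = indicator (- A) x *\<^sub>R f x" for x
  have [measurable]: "A \<in> sets borel" unfolding A_def by measurable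
  have int: "integrable lborel a" "integrable lborel b"
    unfolding a_def b_def using f by (auto intro!: integrable_mult_indicator)
  note [measurable] = borel_measurable_integrable[OF int(2)]
  let ?F = "\<lambda>g \<xi>. \<integral>x. g x * fourier_kernel x \<xi> \<partial>lborel"
  have [measurable]: "?F b \<in> borel_measurable borel"
    unfolding fourier_kernel_def by measurable
  have int': "integrable lborel (\<lambda>x. g x * fourier_kernel x \<xi>)" if "integrable lborel g" for g \<xi>
    unfolding fourier_kernel_def by (intro integrable_mult_unimodular that) auto
  have small: "cmod (?F a \<xi>) \<le> l / 2" for \<xi>
  proof -
    have "ennreal (cmod (?F a \<xi>)) \<le> (\<integral>\<^sup>+x. ennreal (cmod (a x * fourier_kernel x \<xi>)) \<partial>lborel)"
      by (intro integral_norm_bound_ennreal int' int)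
    also have "\<dots> = (\<integral>\<^sup>+y. ennreal (indicator {y. central_mass f \<bar>y\<bar> \<le> l / 2} y * cmod (f y)) \<partial>lborel)"
      by (simp add: norm_mult a_def A_def)
    also have "\<dots> \<le> ennreal (l / 2)"
      using f l by (intro sublevel_central_mass) auto
    finally show ?thesis using l by simp
  qed
  have "f x = a x + b x" for x by (simp add: a_def b_def indicator_def)
  then have split: "?F f \<xi> = ?F a \<xi> + ?F b \<xi>" for \<xi>
    by (simp add: distrib_right Bochner_Integration.integral_add[OF int'[OF int(1)] int'[OF int(2)]])
  have "{\<xi>. l \<le> cmod (?F f \<xi>)} \<subseteq> {\<xi>\<in>UNIV. 1 \<le> ennreal (4 / l\<^sup>2) * ennreal ((cmod (?F b \<xi>))\<^sup>2)}"
  proof safe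
    fix \<xi> assume "l \<le> cmod (?F f \<xi>)"
    also have "\<dots> \<le> cmod (?F a \<xi>) + cmod (?F b \<xi>)" unfolding split by (rule norm_triangle_ineq)
    finally have "l / 2 \<le> cmod (?F b \<xi>)" using small[of \<xi>] by simp
    then have "(l / 2)\<^sup>2 \<le> (cmod (?F b \<xi>))\<^sup>2" using l by (intro power_mono) auto
    then have "1 \<le> 4 / l\<^sup>2 * (cmod (?F b \<xi>))\<^sup>2" using l by (simp add: field_simps)
    then show "1 \<le> ennreal (4 / l\<^sup>2) * ennreal ((cmod (?F b \<xi>))\<^sup>2)"
      by (simp add: ennreal_mult[symmetric])
  qed simp
  then have "emeasure lborel {\<xi>. l \<le> cmod (?F f \<xi>)}
      \<le> emeasure lborel {\<xi>\<in>UNIV. 1 \<le> ennreal (4 / l\<^sup>2) * ennreal ((cmod (?F b \<xi>))\<^sup>2)}"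
    by (intro emeasure_mono) auto
  also have "\<dots> \<le> ennreal (4 / l\<^sup>2) * (\<integral>\<^sup>+\<xi>. ennreal ((cmod (?F b \<xi>))\<^sup>2) * indicator UNIV \<xi> \<partial>lborel)"
    by (intro nn_integral_Markov_inequality) auto
  also have "\<dots> \<le> ennreal (4 / l\<^sup>2) * (\<integral>\<^sup>+x. ennreal ((cmod (b x))\<^sup>2) \<partial>lborel)"
    using plancherel_le[OF int(2)] by (intro mult_left_mono) auto
  also have "(\<integral>\<^sup>+x. ennreal ((cmod (b x))\<^sup>2) \<partial>lborel) = (\<integral>\<^sup>+x. ennreal (indicator {x. l / 2 < central_mass f \<bar>x\<bar>} x * (cmod (f x))\<^sup>2) \<partial>lborel)"
    by (intro nn_integral_cong) (auto simp: b_def A_def indicator_def)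
  finally show ?thesis .
qed

lemma powr_eq_nn_integral:
  fixes p v :: real
  assumes "p > 0" "v \<ge> 0"
  shows "ennreal (v powr p) = (\<integral>\<^sup>+l. ennreal (p * (indicator {0..v} l * l powr (p - 1))) \<partial>lborel)"
  using assms nn_integral_powr_from_0[of "p - 1" v]
  by (simp add: ennreal_mult nn_integral_cmult) (simp add: ennreal_mult[symmetric])

text \<open>Layer-cake formula for |F|^p, with the weak-type bound inserted at each level. After the
  exchange of integrals a point x contributes only at levels l < 2 N(x), and 4 p l^(p-3) integrates
  over them to 4 p (2 N(x))^(p-2) / (p-2), which is the constant in the statement.\<close>

lemma fourier_powr_le_central_mass:
  fixes f :: "real \<Rightarrow> complex" and p :: real
  assumes f: "integrable lborel f" and p: "p > 2"
  shows "(\<integral>\<^sup>+\<xi>. ennreal (cmod (\<integral>x. f x * fourier_kernel x \<xi> \<partial>lborel) powr p) \<partial>lborel)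
    \<le> ennreal (4 * p * 2 powr (p - 2) / (p - 2)) *
      (\<integral>\<^sup>+x. ennreal ((cmod (f x))\<^sup>2 * central_mass f \<bar>x\<bar> powr (p - 2)) \<partial>lborel)"
proof -
  note [measurable] = borel_measurable_integrable[OF f]
  define F where "F \<xi> = (\<integral>x. f x * fourier_kernel x \<xi> \<partial>lborel)" for \<xi>
  have [measurable]: "F \<in> borel_measurable borel"
    unfolding F_def fourier_kernel_def by measurable
  define N where "N x = central_mass f \<bar>x\<bar>" for x
  have [measurable]: "N \<in> borel_measurable borel" unfolding N_def by measurable
  have N_nonneg: "N x \<ge> 0" for x by (simp add: N_def central_mass_nonneg)
  have [measurable]: "Measurable.pred (borel \<Otimes>\<^sub>M borel) (\<lambda>(\<xi>, l). 0 \<le> l \<and> l \<le> cmod (F \<xi>))"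
    "Measurable.pred (borel \<Otimes>\<^sub>M borel) (\<lambda>(l, x). 0 < l \<and> l / 2 < N x)"
    by measurable
  \<comment> \<open>An indicator of an interval that moves with \<xi> is rewritten as a conditional,
    whose joint measurability follows from that of the two comparisons.\<close>
  have m1: "(\<lambda>(\<xi>, l). ennreal (p * (indicator {0..cmod (F \<xi>)} l * l powr (p - 1)))) \<in> borel_measurable (lborel \<Otimes>\<^sub>M lborel)"
  proof -
    have "(\<lambda>(\<xi>, l). ennreal (if 0 \<le> l \<and> l \<le> cmod (F \<xi>) then p * l powr (p - 1) else 0)) \<in> borel_measurable (lborel \<Otimes>\<^sub>M lborel)"
      by measurable
    also have "(\<lambda>(\<xi>, l). ennreal (if 0 \<le> l \<and> l \<le> cmod (F \<xi>) then p * l powr (p - 1) else 0))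
        = (\<lambda>(\<xi>, l). ennreal (p * (indicator {0..cmod (F \<xi>)} l * l powr (p - 1))))"
      by (auto simp: fun_eq_iff indicator_def)
    finally show ?thesis .
  qed
  have m2: "(\<lambda>(l, x). ennreal ((if 0 < l \<and> l / 2 < N x then 1 else 0) * (4 * p * l powr (p - 3))) * ennreal ((cmod (f x))\<^sup>2))
      \<in> borel_measurable (lborel \<Otimes>\<^sub>M lborel)"
    by measurable
  have "(\<integral>\<^sup>+\<xi>. ennreal (cmod (F \<xi>) powr p) \<partial>lborel)
      = (\<integral>\<^sup>+\<xi>. \<integral>\<^sup>+l. ennreal (p * (indicator {0..cmod (F \<xi>)} l * l powr (p - 1))) \<partial>lborel \<partial>lborel)"
    using p by (subst powr_eq_nn_integral) auto
  also have "\<dots> = (\<integral>\<^sup>+l. \<integral>\<^sup>+\<xi>. ennreal (p * (indicator {0..cmod (F \<xi>)} l * l powr (p - 1))) \<partial>lborel \<partial>lborel)"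
    by (rule lborel_pair.Fubini'[symmetric, OF m1])
  also have "\<dots> \<le> (\<integral>\<^sup>+l. \<integral>\<^sup>+x. ennreal ((if 0 < l \<and> l / 2 < N x then 1 else 0) * (4 * p * l powr (p - 3))) * ennreal ((cmod (f x))\<^sup>2) \<partial>lborel \<partial>lborel)"
  proof (rule nn_integral_mono)
    fix l :: real
    show "(\<integral>\<^sup>+\<xi>. ennreal (p * (indicator {0..cmod (F \<xi>)} l * l powr (p - 1))) \<partial>lborel)
      \<le> (\<integral>\<^sup>+x. ennreal ((if 0 < l \<and> l / 2 < N x then 1 else 0) * (4 * p * l powr (p - 3))) * ennreal ((cmod (f x))\<^sup>2) \<partial>lborel)"
    proof (cases "l > 0")
      case True
      have "(\<integral>\<^sup>+\<xi>. ennreal (p * (indicator {0..cmod (F \<xi>)} l * l powr (p - 1))) \<partial>lborel)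
         = (\<integral>\<^sup>+\<xi>. ennreal (p * l powr (p - 1)) * indicator {\<xi>. l \<le> cmod (F \<xi>)} \<xi> \<partial>lborel)"
        using True by (intro nn_integral_cong) (auto simp: indicator_def)
      also have "\<dots> = ennreal (p * l powr (p - 1)) * emeasure lborel {\<xi>. l \<le> cmod (F \<xi>)}"
        by (simp add: nn_integral_cmult)
      also have "\<dots> \<le> ennreal (p * l powr (p - 1)) * (ennreal (4 / l\<^sup>2) *
          (\<integral>\<^sup>+x. ennreal (indicator {x. l / 2 < N x} x * (cmod (f x))\<^sup>2) \<partial>lborel))"
        unfolding F_def N_def by (intro mult_left_mono weak_type_estimate f True) auto
      also have "\<dots> = (\<integral>\<^sup>+x. ennreal (p * l powr (p - 1) * (4 / l\<^sup>2)) * ennreal (indicator {x. l / 2 < N x} x * (cmod (f x))\<^sup>2) \<partial>lborel)"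
        using p by (subst nn_integral_cmult, simp, subst ennreal_mult) (simp_all add: mult.assoc)
      also have "p * l powr (p - 1) * (4 / l\<^sup>2) = 4 * p * l powr (p - 3)"
      proof -
        have "l powr (p - 1) = l powr ((p - 3) + 2)" by simp
        also have "\<dots> = l powr (p - 3) * l\<^sup>2" using True by (subst powr_add) simp
        finally show ?thesis using True by simp
      qed
      also have "(\<integral>\<^sup>+x. ennreal (4 * p * l powr (p - 3)) * ennreal (indicator {x. l / 2 < N x} x * (cmod (f x))\<^sup>2) \<partial>lborel)
        = (\<integral>\<^sup>+x. ennreal ((if 0 < l \<and> l / 2 < N x then 1 else 0) * (4 * p * l powr (p - 3))) * ennreal ((cmod (f x))\<^sup>2) \<partial>lborel)"
        using True by (intro nn_integral_cong) (auto simp: indicator_def)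
      finally show ?thesis .
    next
      case False
      then have z: "p * (indicator {0..cmod (F \<xi>)} l * l powr (p - 1)) = 0" for \<xi>
        by (cases "l = 0") (auto simp: indicator_def)
      show ?thesis unfolding z by simp
    qed
  qed
  also have "\<dots> = (\<integral>\<^sup>+x. \<integral>\<^sup>+l. ennreal ((if 0 < l \<and> l / 2 < N x then 1 else 0) * (4 * p * l powr (p - 3))) * ennreal ((cmod (f x))\<^sup>2) \<partial>lborel \<partial>lborel)"
    by (rule lborel_pair.Fubini'[symmetric, OF m2])
  also have "\<dots> \<le> (\<integral>\<^sup>+x. ennreal (4 * p * 2 powr (p - 2) / (p - 2)) * ennreal ((cmod (f x))\<^sup>2 * N x powr (p - 2)) \<partial>lborel)"
  proof (intro nn_integral_mono)
    fix x :: real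
    have "(\<integral>\<^sup>+l. ennreal ((if 0 < l \<and> l / 2 < N x then 1 else 0) * (4 * p * l powr (p - 3))) * ennreal ((cmod (f x))\<^sup>2) \<partial>lborel)
      = (\<integral>\<^sup>+l. ennreal ((if 0 < l \<and> l / 2 < N x then 1 else 0) * (4 * p * l powr (p - 3))) \<partial>lborel) * ennreal ((cmod (f x))\<^sup>2)"
      by (intro nn_integral_multc) auto
    also have "\<dots> \<le> (\<integral>\<^sup>+l. ennreal (4 * p) * ennreal (indicator {0..2 * N x} l * l powr (p - 3)) \<partial>lborel) * ennreal ((cmod (f x))\<^sup>2)"
      using p by (intro mult_right_mono nn_integral_mono)
        (auto simp: indicator_def ennreal_mult[symmetric])
    also have "\<dots> = ennreal (4 * p) * ennreal ((2 * N x) powr (p - 2) / (p - 2)) * ennreal ((cmod (f x))\<^sup>2)"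
      using nn_integral_powr_from_0[of "p - 3" "2 * N x"] p N_nonneg[of x] by (simp add: nn_integral_cmult)
    also have "\<dots> = ennreal (4 * p * 2 powr (p - 2) / (p - 2)) * ennreal ((cmod (f x))\<^sup>2 * N x powr (p - 2))"
      using p N_nonneg[of x] by (simp add: ennreal_mult[symmetric] powr_mult mult_ac)
    finally show "(\<integral>\<^sup>+l. ennreal ((if 0 < l \<and> l / 2 < N x then 1 else 0) * (4 * p * l powr (p - 3))) * ennreal ((cmod (f x))\<^sup>2) \<partial>lborel)
      \<le> ennreal (4 * p * 2 powr (p - 2) / (p - 2)) * ennreal ((cmod (f x))\<^sup>2 * N x powr (p - 2))" .
  qed
  also have "\<dots> = ennreal (4 * p * 2 powr (p - 2) / (p - 2)) * (\<integral>\<^sup>+x. ennreal ((cmod (f x))\<^sup>2 * N x powr (p - 2)) \<partial>lborel)"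
    by (intro nn_integral_cmult) auto
  finally show ?thesis unfolding F_def N_def .
qed

section \<open>A weighted Hardy inequality for the central mass\<close>

text \<open>Weighted Jensen on the ball of radius \<open>r\<close> with density |y|^(-b). The
  integral of the density is 4 (p-1) r^(1-b), whose power p-1 is the constant times r^(1/2), and the
  density to the power 1-p is |y|^(p-3/2). The exponent \<open>b\<close> used is the midpoint of its
  admissible range.\<close>

lemma central_mass_powr_le:
  fixes f :: "real \<Rightarrow> complex" and p r :: real
  assumes f: "integrable lborel f" and p: "p > 2" and r: "r > 0"
  shows "ennreal (central_mass f r powr p) \<le> ennreal ((4 * (p - 1)) powr (p - 1) * r powr (1/2)) *
    (\<integral>\<^sup>+y. ennreal (indicator {y. \<bar>y\<bar> < r} y * (cmod (f y) powr p * \<bar>y\<bar> powr (p - 3/2))) \<partial>lborel)"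
proof -
  note [measurable] = borel_measurable_integrable[OF f]
  \<comment> \<open>Any exponent with \<open>(p - 2) / (p - 1) < b < 1\<close> would do: \<open>\<bar>y\<bar> powr (- b)\<close> has to be integrable
    at 0, and the remaining power of \<open>r\<close> in Hardy's inequality at infinity.\<close>
  define b where "b = (p - 3/2) / (p - 1)"
  have b: "1 - b = 1 / (2 * (p - 1))" "b * (p - 1) = p - 3/2"
    using p by (auto simp: b_def field_simps)
  have b1: "- b > -1" using p by (simp add: b_def divide_less_eq)
  define H where "H = 4 * (p - 1) * r powr (1 - b)"
  have H: "(\<integral>\<^sup>+y. ennreal (indicator {y. \<bar>y\<bar> < r} y * \<bar>y\<bar> powr (- b)) \<partial>lborel) = ennreal H"
  proof -
    have "2 * r powr (- b + 1) / (- b + 1) = 2 * r powr (1 - b) / (1 - b)" by simp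
    also have "\<dots> = H" unfolding H_def by (subst (2) b(1)) (simp add: algebra_simps)
    finally show ?thesis using nn_integral_abs_powr_near_0[OF b1, of r] r by simp
  qed
  have "ennreal (central_mass f r powr p) \<le> ennreal (H powr (p - 1)) *
    (\<integral>\<^sup>+y. ennreal ((indicator {y. \<bar>y\<bar> < r} y * cmod (f y)) powr p * (indicator {y. \<bar>y\<bar> < r} y * \<bar>y\<bar> powr (- b)) powr (1 - p)) \<partial>lborel)"
  proof (rule weighted_jensen)
    show "AE y in lborel. indicator {y. \<bar>y\<bar> < r} y * \<bar>y\<bar> powr (- b) = 0 \<longrightarrow> indicator {y. \<bar>y\<bar> < r} y * cmod (f y) = 0"
      using AE_lborel_singleton[of "0::real"] by eventually_elim (auto simp: indicator_def)
  qed (use p r H nn_integral_central_mass[OF f] in \<open>auto simp: central_mass_nonneg H_def\<close>)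
  also have "H powr (p - 1) = (4 * (p - 1)) powr (p - 1) * r powr (1/2)"
  proof -
    have e: "(1 - b) * (p - 1) = 1 / 2" using p b(1) by (simp add: field_simps)
    have "H powr (p - 1) = (4 * (p - 1)) powr (p - 1) * (r powr (1 - b)) powr (p - 1)"
      unfolding H_def by (rule powr_mult)
    then show ?thesis unfolding powr_powr e .
  qed
  also have "(\<lambda>y. ennreal ((indicator {y. \<bar>y\<bar> < r} y * cmod (f y)) powr p * (indicator {y. \<bar>y\<bar> < r} y * \<bar>y\<bar> powr (- b)) powr (1 - p)))
    = (\<lambda>y. ennreal (indicator {y. \<bar>y\<bar> < r} y * (cmod (f y) powr p * \<bar>y\<bar> powr (p - 3/2))))"
  proof
    fix y
    have "(\<bar>y\<bar> powr (- b)) powr (1 - p) = \<bar>y\<bar> powr (p - 3/2)"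
      unfolding powr_powr b(2)[symmetric] by (simp add: algebra_simps)
    then show "ennreal ((indicator {y. \<bar>y\<bar> < r} y * cmod (f y)) powr p * (indicator {y. \<bar>y\<bar> < r} y * \<bar>y\<bar> powr (- b)) powr (1 - p))
      = ennreal (indicator {y. \<bar>y\<bar> < r} y * (cmod (f y) powr p * \<bar>y\<bar> powr (p - 3/2)))"
      by (simp add: indicator_def)
  qed
  finally show ?thesis .
qed

text \<open>Insert the bound for a single radius and exchange the integrals. The remaining power of
  |x| is -2 + 1/2 = -3/2, integrable at infinity: over |x| > |y| it gives 4 |y|^(-1/2), which lowers
  |y|^(p-3/2) to the weight |y|^(p-2) and is the source of the leading factor 4.\<close>

lemma hardy_central_mass:
  fixes f :: "real \<Rightarrow> complex" and p :: real
  assumes f: "integrable lborel f" and p: "p > 2"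
  shows "(\<integral>\<^sup>+x. ennreal (central_mass f \<bar>x\<bar> powr p * \<bar>x\<bar> powr (-2)) \<partial>lborel)
    \<le> ennreal (4 * (4 * (p - 1)) powr (p - 1)) * (\<integral>\<^sup>+x. ennreal (cmod (f x) powr p * \<bar>x\<bar> powr (p - 2)) \<partial>lborel)"
proof -
  note [measurable] = borel_measurable_integrable[OF f]
  define K where "K = (4 * (p - 1)) powr (p - 1)"
  have K: "K \<ge> 0" by (simp add: K_def)
  define \<phi> where "\<phi> y = cmod (f y) powr p * \<bar>y\<bar> powr (p - 3/2)" for y
  have [measurable]: "\<phi> \<in> borel_measurable borel" unfolding \<phi>_def by measurable
  have \<phi>: "\<phi> y \<ge> 0" for y by (simp add: \<phi>_def)
  have [measurable]: "Measurable.pred (borel \<Otimes>\<^sub>M borel) (\<lambda>(x, y). \<bar>y\<bar> < \<bar>x :: real\<bar>)" by measurable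
  have m: "(\<lambda>(x, y). ennreal (if \<bar>y\<bar> < \<bar>x\<bar> then K * \<bar>x\<bar> powr (-3/2) else 0) * ennreal (\<phi> y)) \<in> borel_measurable (lborel \<Otimes>\<^sub>M lborel)"
    by measurable
  have "(\<integral>\<^sup>+x. ennreal (central_mass f \<bar>x\<bar> powr p * \<bar>x\<bar> powr (-2)) \<partial>lborel)
    \<le> (\<integral>\<^sup>+x. \<integral>\<^sup>+y. ennreal (if \<bar>y\<bar> < \<bar>x\<bar> then K * \<bar>x\<bar> powr (-3/2) else 0) * ennreal (\<phi> y) \<partial>lborel \<partial>lborel)"
  proof (intro nn_integral_mono)
    fix x :: real
    show "ennreal (central_mass f \<bar>x\<bar> powr p * \<bar>x\<bar> powr (-2))
      \<le> (\<integral>\<^sup>+y. ennreal (if \<bar>y\<bar> < \<bar>x\<bar> then K * \<bar>x\<bar> powr (-3/2) else 0) * ennreal (\<phi> y) \<partial>lborel)"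
    \<comment> \<open>At the origin the left side is 0, because \<open>0 powr (-2)\<close> is
      0.\<close>
    proof (cases "x = 0")
      case False
      have "ennreal (central_mass f \<bar>x\<bar> powr p * \<bar>x\<bar> powr (-2))
        = ennreal (\<bar>x\<bar> powr (-2)) * ennreal (central_mass f \<bar>x\<bar> powr p)"
        by (simp add: ennreal_mult mult.commute)
      also have "\<dots> \<le> ennreal (\<bar>x\<bar> powr (-2)) * (ennreal (K * \<bar>x\<bar> powr (1/2)) *
          (\<integral>\<^sup>+y. ennreal (indicator {y. \<bar>y\<bar> < \<bar>x\<bar>} y * \<phi> y) \<partial>lborel))"
        unfolding K_def \<phi>_def using False by (intro mult_left_mono central_mass_powr_le f p) auto
      also have "\<dots> = ennreal (\<bar>x\<bar> powr (-2) * (K * \<bar>x\<bar> powr (1/2))) * (\<integral>\<^sup>+y. ennreal (indicator {y. \<bar>y\<bar> < \<bar>x\<bar>} y * \<phi> y) \<partial>lborel)"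
        using K by (simp add: ennreal_mult mult.assoc)
      also have "\<bar>x\<bar> powr (-2) * (K * \<bar>x\<bar> powr (1/2)) = K * \<bar>x\<bar> powr (-3/2)"
      proof -
        have "\<bar>x\<bar> powr (-2) * \<bar>x\<bar> powr (1/2) = \<bar>x\<bar> powr (-3/2)"
          by (subst powr_add[symmetric]) simp
        then show ?thesis by (simp add: mult_ac)
      qed
      also have "ennreal (K * \<bar>x\<bar> powr (-3/2)) * (\<integral>\<^sup>+y. ennreal (indicator {y. \<bar>y\<bar> < \<bar>x\<bar>} y * \<phi> y) \<partial>lborel)
        = (\<integral>\<^sup>+y. ennreal (K * \<bar>x\<bar> powr (-3/2)) * ennreal (indicator {y. \<bar>y\<bar> < \<bar>x\<bar>} y * \<phi> y) \<partial>lborel)"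
        by (intro nn_integral_cmult[symmetric]) auto
      also have "\<dots> = (\<integral>\<^sup>+y. ennreal (if \<bar>y\<bar> < \<bar>x\<bar> then K * \<bar>x\<bar> powr (-3/2) else 0) * ennreal (\<phi> y) \<partial>lborel)"
        by (intro nn_integral_cong) (auto simp: indicator_def)
      finally show ?thesis .
    qed simp
  qed
  also have "\<dots> = (\<integral>\<^sup>+y. \<integral>\<^sup>+x. ennreal (if \<bar>y\<bar> < \<bar>x\<bar> then K * \<bar>x\<bar> powr (-3/2) else 0) * ennreal (\<phi> y) \<partial>lborel \<partial>lborel)"
    by (rule lborel_pair.Fubini'[symmetric, OF m])
  also have "\<dots> = (\<integral>\<^sup>+y. ennreal (4 * K) * ennreal (cmod (f y) powr p * \<bar>y\<bar> powr (p - 2)) \<partial>lborel)"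
  proof (intro nn_integral_cong_AE)
    show "AE y in lborel. (\<integral>\<^sup>+x. ennreal (if \<bar>y\<bar> < \<bar>x\<bar> then K * \<bar>x\<bar> powr (-3/2) else 0) * ennreal (\<phi> y) \<partial>lborel)
      = ennreal (4 * K) * ennreal (cmod (f y) powr p * \<bar>y\<bar> powr (p - 2))"
      using AE_lborel_singleton[of "0::real"]
    proof eventually_elim
      case (elim y)
      have "(\<integral>\<^sup>+x. ennreal (if \<bar>y\<bar> < \<bar>x\<bar> then K * \<bar>x\<bar> powr (-3/2) else 0) * ennreal (\<phi> y) \<partial>lborel)
        = (\<integral>\<^sup>+x. ennreal K * ennreal (indicator {x. \<bar>y\<bar> < \<bar>x\<bar>} x * \<bar>x\<bar> powr (-3/2)) * ennreal (\<phi> y) \<partial>lborel)"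
        using K by (intro nn_integral_cong) (auto simp: indicator_def ennreal_mult)
      also have "\<dots> = ennreal K * ennreal (4 * \<bar>y\<bar> powr (-1/2)) * ennreal (\<phi> y)"
        using nn_integral_abs_powr_away_0[of "-3/2" "\<bar>y\<bar>"] elim
        by (simp add: nn_integral_multc nn_integral_cmult)
      also have "\<dots> = ennreal (4 * K) * ennreal (\<bar>y\<bar> powr (-1/2) * \<phi> y)"
        using K \<phi> by (simp add: ennreal_mult[symmetric] mult_ac)
      also have "\<bar>y\<bar> powr (-1/2) * \<phi> y = cmod (f y) powr p * \<bar>y\<bar> powr (p - 2)"
      proof -
        have "\<bar>y\<bar> powr (-1/2) * \<bar>y\<bar> powr (p - 3/2) = \<bar>y\<bar> powr (p - 2)"
          by (subst powr_add[symmetric]) simp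
        then show ?thesis by (simp add: \<phi>_def mult_ac)
      qed
      finally show ?case .
    qed
  qed
  also have "\<dots> = ennreal (4 * K) * (\<integral>\<^sup>+y. ennreal (cmod (f y) powr p * \<bar>y\<bar> powr (p - 2)) \<partial>lborel)"
    by (intro nn_integral_cmult) auto
  finally show ?thesis unfolding K_def .
qed

section \<open>The one-dimensional inequality\<close>

lemma sq_powr_le_add:
  fixes u v x p :: real
  assumes p: "p > 2" and nonneg: "u \<ge> 0" "v \<ge> 0" and x: "x > 0"
  shows "u\<^sup>2 * v powr (p - 2) \<le> u powr p * x powr (p - 2) + v powr p * x powr (-2)"
proof -
  \<comment> \<open>Multiplying by x^2 removes \<open>x\<close>: the claim becomes w^2 v^(p-2) \<le>
    w^p + v^p, and the left side is at most the p-th power of the larger of \<open>w\<close> and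
    \<open>v\<close>.\<close>
  define w where "w = u * x"
  have w: "w \<ge> 0" using assms by (simp add: w_def)
  have sq: "t powr p = t\<^sup>2 * t powr (p - 2)" if "t \<ge> 0" for t :: real
  proof (cases "t = 0")
    case False
    then have "t > 0" using that by simp
    have "t powr p = t powr (2 + (p - 2))" by simp
    also have "\<dots> = t\<^sup>2 * t powr (p - 2)" using \<open>t > 0\<close> by (subst powr_add) simp
    finally show ?thesis .
  qed simp
  have "w\<^sup>2 * v powr (p - 2) \<le> w powr p + v powr p"
  proof (cases "w \<le> v")
    case True
    then have "w\<^sup>2 * v powr (p - 2) \<le> v\<^sup>2 * v powr (p - 2)"
      using w by (intro mult_right_mono power_mono) auto
    then show ?thesis using sq[of v] nonneg by (simp add: add_increasing)
  next
    case False
    then have "w\<^sup>2 * v powr (p - 2) \<le> w\<^sup>2 * w powr (p - 2)"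
      using p nonneg by (intro mult_left_mono powr_mono2) auto
    then show ?thesis using sq[of w] w by (simp add: add_increasing2)
  qed
  then have "w\<^sup>2 * v powr (p - 2) * x powr (-2) \<le> (w powr p + v powr p) * x powr (-2)"
    by (intro mult_right_mono) auto
  also have "w\<^sup>2 * v powr (p - 2) * x powr (-2) = u\<^sup>2 * v powr (p - 2)"
    using x by (simp add: w_def powr_minus field_simps)
  also have "(w powr p + v powr p) * x powr (-2) = u powr p * (x powr p * x powr (-2)) + v powr p * x powr (-2)"
    using x nonneg by (simp add: w_def powr_mult distrib_right mult.assoc)
  also have "x powr p * x powr (-2) = x powr (p - 2)"
    by (subst powr_add[symmetric]) simp
  finally show ?thesis .
qed

proposition hardy_littlewood_1d:
  fixes p :: real
  assumes "2 \<le> p"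
  shows "\<exists>C>0. \<forall>f. integrable lborel f \<longrightarrow>
    (\<integral>\<^sup>+\<xi>. ennreal (cmod (\<integral>x. f x * fourier_kernel x \<xi> \<partial>lborel) powr p) \<partial>lborel)
      \<le> ennreal C * (\<integral>\<^sup>+x. ennreal (cmod (f x) powr p * \<bar>x\<bar> powr (p - 2)) \<partial>lborel)"
proof (cases "p = 2")
  case True
  have "(\<integral>\<^sup>+\<xi>. ennreal (cmod (\<integral>x. f x * fourier_kernel x \<xi> \<partial>lborel) powr p) \<partial>lborel)
      \<le> ennreal 1 * (\<integral>\<^sup>+x. ennreal (cmod (f x) powr p * \<bar>x\<bar> powr (p - 2)) \<partial>lborel)"
    if f: "integrable lborel f" for f
  proof -
    have "(\<integral>\<^sup>+x. ennreal (cmod (f x) powr p * \<bar>x\<bar> powr (p - 2)) \<partial>lborel) = (\<integral>\<^sup>+x. ennreal ((cmod (f x))\<^sup>2) \<partial>lborel)"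
    proof (intro nn_integral_cong_AE)
      \<comment> \<open>Only almost everywhere: at x = 0 the weight \<open>0 powr 0\<close> is 0 and
        not 1.\<close>
      show "AE x in lborel. ennreal (cmod (f x) powr p * \<bar>x\<bar> powr (p - 2)) = ennreal ((cmod (f x))\<^sup>2)"
        using AE_lborel_singleton[of "0::real"] by eventually_elim (simp add: True)
    qed
    then show ?thesis using plancherel_le[OF f] by (simp add: True)
  qed
  then show ?thesis by (intro exI[of _ 1]) auto
next
  case False
  with assms have p: "p > 2" by simp
  define A where "A = 4 * p * 2 powr (p - 2) / (p - 2)"
  define B where "B = 4 * (4 * (p - 1)) powr (p - 1)"
  have A: "A > 0" and B: "B \<ge> 0" using p by (auto simp: A_def B_def)
  have "(\<integral>\<^sup>+\<xi>. ennreal (cmod (\<integral>x. f x * fourier_kernel x \<xi> \<partial>lborel) powr p) \<partial>lborel)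
      \<le> ennreal (A * (1 + B)) * (\<integral>\<^sup>+x. ennreal (cmod (f x) powr p * \<bar>x\<bar> powr (p - 2)) \<partial>lborel)" (is "?L \<le> _ * ?R")
    if f: "integrable lborel f" for f
  proof -
    note [measurable] = borel_measurable_integrable[OF f]
    have "?L \<le> ennreal A * (\<integral>\<^sup>+x. ennreal ((cmod (f x))\<^sup>2 * central_mass f \<bar>x\<bar> powr (p - 2)) \<partial>lborel)"
      unfolding A_def by (rule fourier_powr_le_central_mass[OF f p])
    also have "\<dots> \<le> ennreal A * (\<integral>\<^sup>+x. ennreal (cmod (f x) powr p * \<bar>x\<bar> powr (p - 2)) +
        ennreal (central_mass f \<bar>x\<bar> powr p * \<bar>x\<bar> powr (-2)) \<partial>lborel)"
    proof (intro mult_left_mono nn_integral_mono_AE)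
      show "AE x in lborel. ennreal ((cmod (f x))\<^sup>2 * central_mass f \<bar>x\<bar> powr (p - 2))
        \<le> ennreal (cmod (f x) powr p * \<bar>x\<bar> powr (p - 2)) + ennreal (central_mass f \<bar>x\<bar> powr p * \<bar>x\<bar> powr (-2))"
        using AE_lborel_singleton[of "0::real"]
      proof eventually_elim
        case (elim x)
        then show ?case
          using sq_powr_le_add[OF p norm_ge_zero[of "f x"] central_mass_nonneg[of f "\<bar>x\<bar>"], of "\<bar>x\<bar>"]
          by (simp add: ennreal_plus[symmetric] del: ennreal_plus)
      qed
    qed simp
    also have "\<dots> = ennreal A * (?R + (\<integral>\<^sup>+x. ennreal (central_mass f \<bar>x\<bar> powr p * \<bar>x\<bar> powr (-2)) \<partial>lborel))"
      by (subst nn_integral_add) auto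
    also have "\<dots> \<le> ennreal A * (?R + ennreal B * ?R)"
      unfolding B_def by (intro mult_left_mono add_left_mono hardy_central_mass f p) auto
    also have "\<dots> = ennreal (A * (1 + B)) * ?R"
      using A B by (simp add: ennreal_mult distrib_right mult.assoc)
    finally show ?thesis .
  qed
  moreover have "A * (1 + B) > 0" using A B by (intro mult_pos_pos) auto
  ultimately show ?thesis by blast
qed

subsection \<open>Tensor products\<close>

text \<open>Measure, kernel and weight are parameters so that the class is stable under binary
  products and under images of measures. The same measure is used for positions and frequencies, as
  for the Fourier transform.\<close>

definition paley_ineq ::
    "'a measure \<Rightarrow> ('a \<Rightarrow> 'a \<Rightarrow> complex) \<Rightarrow> ('a \<Rightarrow> real) \<Rightarrow> real \<Rightarrow> real \<Rightarrow> bool" where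
  "paley_ineq M \<kappa> w p C \<longleftrightarrow> (\<forall>f. integrable M f \<longrightarrow>
    (\<integral>\<^sup>+\<xi>. ennreal (cmod (\<integral>x. f x * \<kappa> x \<xi> \<partial>M) powr p) \<partial>M)
      \<le> ennreal C * (\<integral>\<^sup>+x. ennreal (cmod (f x) powr p * w x) \<partial>M))"

lemma paley_ineqD:
  assumes "paley_ineq M \<kappa> w p C" "integrable M f"
  shows "(\<integral>\<^sup>+\<xi>. ennreal (cmod (\<integral>x. f x * \<kappa> x \<xi> \<partial>M) powr p) \<partial>M)
      \<le> ennreal C * (\<integral>\<^sup>+x. ennreal (cmod (f x) powr p * w x) \<partial>M)"
  using assms unfolding paley_ineq_def by blast

text \<open>The full transform is the second transform of the partial transform \<open>G\<close>.
  The inequality for \<open>M2\<close> is applied to \<open>G \<xi>\<close> at each fixed frequency,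
  then the integrals are exchanged, and the inequality for \<open>M1\<close> is applied to the
  slices of \<open>f\<close> at fixed \<open>y\<close>. Both inequalities carry the same power p, so
  Tonelli suffices and Minkowski's inequality does not enter.\<close>

lemma paley_ineq_pair:
  fixes \<kappa>1 :: "'a \<Rightarrow> 'a \<Rightarrow> complex" and \<kappa>2 :: "'b \<Rightarrow> 'b \<Rightarrow> complex"
  assumes "sigma_finite_measure M1" "sigma_finite_measure M2"
    and P1: "paley_ineq M1 \<kappa>1 w1 p C1" and P2: "paley_ineq M2 \<kappa>2 w2 p C2"
    and \<kappa>1 [measurable]: "(\<lambda>z. \<kappa>1 (fst z) (snd z)) \<in> borel_measurable (M1 \<Otimes>\<^sub>M M1)"
    and \<kappa>2 [measurable]: "(\<lambda>z. \<kappa>2 (fst z) (snd z)) \<in> borel_measurable (M2 \<Otimes>\<^sub>M M2)"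
    and bound: "\<And>x \<xi>. cmod (\<kappa>1 x \<xi>) \<le> 1" "\<And>x \<xi>. cmod (\<kappa>2 x \<xi>) \<le> 1"
    and [measurable]: "w1 \<in> borel_measurable M1" "w2 \<in> borel_measurable M2"
    and nonneg: "\<And>x. w1 x \<ge> 0" "\<And>x. w2 x \<ge> 0" "C1 \<ge> 0" "C2 \<ge> 0"
  shows "paley_ineq (M1 \<Otimes>\<^sub>M M2) (\<lambda>z \<zeta>. \<kappa>1 (fst z) (fst \<zeta>) * \<kappa>2 (snd z) (snd \<zeta>))
    (\<lambda>z. w1 (fst z) * w2 (snd z)) p (C1 * C2)"
  unfolding paley_ineq_def
proof (intro allI impI)
  fix f :: "'a \<times> 'b \<Rightarrow> complex" assume f: "integrable (M1 \<Otimes>\<^sub>M M2) f"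
  note [measurable] = borel_measurable_integrable[OF f]
  interpret M1: sigma_finite_measure M1 by fact
  interpret M2: sigma_finite_measure M2 by fact
  interpret pair_sigma_finite M1 M2 ..
  interpret P: sigma_finite_measure "M1 \<Otimes>\<^sub>M M2" by (rule sigma_finite_measure_axioms)
  have \<kappa>1': "(\<lambda>x. \<kappa>1 x \<xi>) \<in> borel_measurable M1" if "\<xi> \<in> space M1" for \<xi>
    using measurable_compose[OF measurable_Pair2'[OF that, where ?M1.0 = M1] \<kappa>1] by simp
  have \<kappa>2': "(\<lambda>x. \<kappa>2 x \<xi>) \<in> borel_measurable M2" if "\<xi> \<in> space M2" for \<xi>
    using measurable_compose[OF measurable_Pair2'[OF that, where ?M1.0 = M2] \<kappa>2] by simp
  define G where "G \<xi> y = (\<integral>x. f (x, y) * \<kappa>1 x \<xi> \<partial>M1)" for \<xi> y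
  define F where "F \<zeta> = (\<integral>z. f z * (\<kappa>1 (fst z) (fst \<zeta>) * \<kappa>2 (snd z) (snd \<zeta>)) \<partial>(M1 \<Otimes>\<^sub>M M2))" for \<zeta>
  \<comment> \<open>The kernel is written as a function of a pair applied to a pair, the form in
    which its joint measurability is assumed.\<close>
  have [measurable]: "(\<lambda>z. G (fst z) (snd z)) \<in> borel_measurable (M1 \<Otimes>\<^sub>M M2)"
  proof -
    have "(\<lambda>z. \<integral>x. f (x, snd z) * (\<lambda>z. \<kappa>1 (fst z) (snd z)) (x, fst z) \<partial>M1) \<in> borel_measurable (M1 \<Otimes>\<^sub>M M2)"
      by measurable
    then show ?thesis by (simp add: G_def)
  qed
  have [measurable]: "F \<in> borel_measurable (M1 \<Otimes>\<^sub>M M2)"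
  proof -
    have "(\<lambda>\<zeta>. \<integral>z. f z * ((\<lambda>z. \<kappa>1 (fst z) (snd z)) (fst z, fst \<zeta>) * (\<lambda>z. \<kappa>2 (fst z) (snd z)) (snd z, snd \<zeta>))
        \<partial>(M1 \<Otimes>\<^sub>M M2)) \<in> borel_measurable (M1 \<Otimes>\<^sub>M M2)"
      by measurable
    then show ?thesis by (simp add: F_def[abs_def])
  qed
  have int1: "integrable (M1 \<Otimes>\<^sub>M M2) (\<lambda>(x, y). f (x, y) * \<kappa>1 x \<xi>)" if "\<xi> \<in> space M1" for \<xi>
    using integrable_mult_unimodular[OF f measurable_compose[OF measurable_fst \<kappa>1'[OF that]] bound(1)]
    by (simp add: case_prod_beta')
  \<comment> \<open>This holds at every frequency: \<open>f\<close> times a kernel bounded by 1 is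
    integrable on the whole product, and Fubini integrates out x.\<close>
  have int_G: "integrable M2 (G \<xi>)" if "\<xi> \<in> space M1" for \<xi>
    using integrable_snd[OF int1[OF that]] by (simp add: G_def[abs_def])
  have F_eq: "F (\<xi>, \<eta>) = (\<integral>y. G \<xi> y * \<kappa>2 y \<eta> \<partial>M2)" if "\<xi> \<in> space M1" "\<eta> \<in> space M2" for \<xi> \<eta>
  proof -
    have "integrable (M1 \<Otimes>\<^sub>M M2) (\<lambda>(x, y). f (x, y) * \<kappa>1 x \<xi> * \<kappa>2 y \<eta>)"
      using integrable_mult_unimodular[OF int1[OF that(1)] measurable_compose[OF measurable_snd \<kappa>2'[OF that(2)]] bound(2)]
      by (simp add: case_prod_beta')
    from integral_snd[OF this] show ?thesis
      by (simp add: F_def G_def case_prod_beta' mult.assoc[symmetric])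
  qed
  have m: "(\<lambda>(\<xi>, y). ennreal (cmod (G \<xi> y) powr p * w2 y)) \<in> borel_measurable (M1 \<Otimes>\<^sub>M M2)"
    by (simp add: case_prod_beta) measurable
  have "(\<integral>\<^sup>+\<xi>. \<integral>\<^sup>+y. ennreal (cmod (G \<xi> y) powr p * w2 y) \<partial>M2 \<partial>M1)
      = (\<integral>\<^sup>+y. \<integral>\<^sup>+\<xi>. ennreal (cmod (G \<xi> y) powr p * w2 y) \<partial>M1 \<partial>M2)"
    by (rule Fubini'[symmetric, OF m])
  also have "\<dots> \<le> (\<integral>\<^sup>+y. \<integral>\<^sup>+x. ennreal C1 * ennreal (cmod (f (x, y)) powr p * (w1 x * w2 y)) \<partial>M1 \<partial>M2)"
  proof (intro nn_integral_mono_AE)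
    \<comment> \<open>Slices of \<open>f\<close> itself are integrable only for almost every
      \<open>y\<close>, so here the comparison is made almost everywhere.\<close>
    have "integrable (M1 \<Otimes>\<^sub>M M2) (\<lambda>(x, y). f (x, y))" using f by simp
    from AE_integrable_snd[OF this] show "AE y in M2. (\<integral>\<^sup>+\<xi>. ennreal (cmod (G \<xi> y) powr p * w2 y) \<partial>M1)
      \<le> (\<integral>\<^sup>+x. ennreal C1 * ennreal (cmod (f (x, y)) powr p * (w1 x * w2 y)) \<partial>M1)"
      using AE_space
    proof eventually_elim
      case (elim y)
      have [measurable]: "(\<lambda>x. f (x, y)) \<in> borel_measurable M1" "(\<lambda>\<xi>. G \<xi> y) \<in> borel_measurable M1"
        using elim(2) measurable_compose[OF measurable_Pair2'[OF elim(2), where ?M1.0 = M1], of "\<lambda>z. G (fst z) (snd z)" borel]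
        by simp_all
      have "(\<integral>\<^sup>+\<xi>. ennreal (cmod (G \<xi> y) powr p * w2 y) \<partial>M1) = ennreal (w2 y) * (\<integral>\<^sup>+\<xi>. ennreal (cmod (G \<xi> y) powr p) \<partial>M1)"
        using nonneg by (subst nn_integral_cmult[symmetric]) (auto simp: ennreal_mult mult.commute)
      also have "\<dots> \<le> ennreal (w2 y) * (ennreal C1 * (\<integral>\<^sup>+x. ennreal (cmod (f (x, y)) powr p * w1 x) \<partial>M1))"
        unfolding G_def by (intro mult_left_mono paley_ineqD[OF P1] elim) auto
      also have "\<dots> = (\<integral>\<^sup>+x. ennreal (w2 y) * (ennreal C1 * ennreal (cmod (f (x, y)) powr p * w1 x)) \<partial>M1)"
        by (simp add: nn_integral_cmult)
      also have "\<dots> = (\<integral>\<^sup>+x. ennreal C1 * ennreal (cmod (f (x, y)) powr p * (w1 x * w2 y)) \<partial>M1)"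
        using nonneg by (intro nn_integral_cong) (simp add: ennreal_mult[symmetric] mult_ac)
      finally show ?case .
    qed
  qed
  also have "\<dots> = (\<integral>\<^sup>+z. ennreal C1 * ennreal (cmod (f z) powr p * (w1 (fst z) * w2 (snd z))) \<partial>(M1 \<Otimes>\<^sub>M M2))"
    by (subst nn_integral_snd[symmetric]) auto
  also have "\<dots> = ennreal C1 * (\<integral>\<^sup>+z. ennreal (cmod (f z) powr p * (w1 (fst z) * w2 (snd z))) \<partial>(M1 \<Otimes>\<^sub>M M2))"
    by (intro nn_integral_cmult) auto
  finally have step: "(\<integral>\<^sup>+\<xi>. \<integral>\<^sup>+y. ennreal (cmod (G \<xi> y) powr p * w2 y) \<partial>M2 \<partial>M1)
      \<le> ennreal C1 * (\<integral>\<^sup>+z. ennreal (cmod (f z) powr p * (w1 (fst z) * w2 (snd z))) \<partial>(M1 \<Otimes>\<^sub>M M2))" .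
  have "(\<integral>\<^sup>+\<zeta>. ennreal (cmod (F \<zeta>) powr p) \<partial>(M1 \<Otimes>\<^sub>M M2)) = (\<integral>\<^sup>+\<xi>. \<integral>\<^sup>+\<eta>. ennreal (cmod (F (\<xi>, \<eta>)) powr p) \<partial>M2 \<partial>M1)"
    by (subst M2.nn_integral_fst[symmetric]) auto
  also have "\<dots> = (\<integral>\<^sup>+\<xi>. \<integral>\<^sup>+\<eta>. ennreal (cmod (\<integral>y. G \<xi> y * \<kappa>2 y \<eta> \<partial>M2) powr p) \<partial>M2 \<partial>M1)"
    by (intro nn_integral_cong) (simp add: F_eq)
  also have "\<dots> \<le> (\<integral>\<^sup>+\<xi>. ennreal C2 * (\<integral>\<^sup>+y. ennreal (cmod (G \<xi> y) powr p * w2 y) \<partial>M2) \<partial>M1)"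
    by (intro nn_integral_mono paley_ineqD[OF P2] int_G)
  also have "\<dots> = ennreal C2 * (\<integral>\<^sup>+\<xi>. \<integral>\<^sup>+y. ennreal (cmod (G \<xi> y) powr p * w2 y) \<partial>M2 \<partial>M1)"
    using m by (intro nn_integral_cmult M2.borel_measurable_nn_integral)
  also have "\<dots> \<le> ennreal C2 * (ennreal C1 * (\<integral>\<^sup>+z. ennreal (cmod (f z) powr p * (w1 (fst z) * w2 (snd z))) \<partial>(M1 \<Otimes>\<^sub>M M2)))"
    by (intro mult_left_mono step) simp
  also have "\<dots> = ennreal (C1 * C2) * (\<integral>\<^sup>+z. ennreal (cmod (f z) powr p * (w1 (fst z) * w2 (snd z))) \<partial>(M1 \<Otimes>\<^sub>M M2))"
    using nonneg by (simp only: ennreal_mult mult_ac)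
  finally show "(\<integral>\<^sup>+\<zeta>. ennreal (cmod (\<integral>z. f z * (\<kappa>1 (fst z) (fst \<zeta>) * \<kappa>2 (snd z) (snd \<zeta>)) \<partial>(M1 \<Otimes>\<^sub>M M2)) powr p) \<partial>(M1 \<Otimes>\<^sub>M M2))
    \<le> ennreal (C1 * C2) * (\<integral>\<^sup>+z. ennreal (cmod (f z) powr p * (w1 (fst z) * w2 (snd z))) \<partial>(M1 \<Otimes>\<^sub>M M2))"
    unfolding F_def .
qed

text \<open>Positions and frequencies are pulled back along the same map, so kernel and weight only
  have to match on its image. It serves twice: to add an index to a product, and to pass from
  coordinates to vectors.\<close>

lemma paley_ineq_distr:
  fixes M :: "'a measure" and N :: "'b measure"
  assumes "sigma_finite_measure M" and P: "paley_ineq M \<kappa> w p C"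
    and T [measurable]: "T \<in> measurable M N"
    and \<kappa>' [measurable]: "(\<lambda>z. \<kappa>' (fst z) (snd z)) \<in> borel_measurable (N \<Otimes>\<^sub>M N)"
    and [measurable]: "w' \<in> borel_measurable N"
    and \<kappa>: "\<And>x \<xi>. x \<in> space M \<Longrightarrow> \<xi> \<in> space M \<Longrightarrow> \<kappa>' (T x) (T \<xi>) = \<kappa> x \<xi>"
    and w: "\<And>x. x \<in> space M \<Longrightarrow> w' (T x) = w x"
  shows "paley_ineq (distr M N T) \<kappa>' w' p C"
  unfolding paley_ineq_def
proof (intro allI impI)
  fix f :: "'b \<Rightarrow> complex" assume f: "integrable (distr M N T) f"
  then have [measurable]: "f \<in> borel_measurable N" by auto
  have fT: "integrable M (\<lambda>x. f (T x))" using f by (simp add: integrable_distr_eq)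
  interpret sigma_finite_measure M by fact
  have \<kappa>'': "(\<lambda>x. \<kappa>' x \<xi>) \<in> borel_measurable N" if "\<xi> \<in> space N" for \<xi>
    using measurable_compose[OF measurable_Pair2'[OF that, where ?M1.0 = N] \<kappa>'] by simp
  have eq: "(\<integral>x. f x * \<kappa>' x \<xi> \<partial>distr M N T) = (\<integral>x. f (T x) * \<kappa>' (T x) \<xi> \<partial>M)" if "\<xi> \<in> space N" for \<xi>
    using \<kappa>''[OF that] by (intro integral_distr) auto
  have m: "(\<lambda>\<xi>. \<integral>x. f (T x) * \<kappa>' (T x) \<xi> \<partial>M) \<in> borel_measurable N"
  proof -
    have "(\<lambda>\<xi>. \<integral>x. f (T x) * (\<lambda>z. \<kappa>' (fst z) (snd z)) (T x, \<xi>) \<partial>M) \<in> borel_measurable N"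
      by measurable
    then show ?thesis by simp
  qed
  have "(\<integral>\<^sup>+\<xi>. ennreal (cmod (\<integral>x. f x * \<kappa>' x \<xi> \<partial>distr M N T) powr p) \<partial>distr M N T)
      = (\<integral>\<^sup>+\<xi>. ennreal (cmod (\<integral>x. f (T x) * \<kappa>' (T x) \<xi> \<partial>M) powr p) \<partial>distr M N T)"
    by (intro nn_integral_cong) (simp add: eq)
  also have "\<dots> = (\<integral>\<^sup>+\<xi>. ennreal (cmod (\<integral>x. f (T x) * \<kappa>' (T x) (T \<xi>) \<partial>M) powr p) \<partial>M)"
    using m by (intro nn_integral_distr) auto
  also have "\<dots> = (\<integral>\<^sup>+\<xi>. ennreal (cmod (\<integral>x. f (T x) * \<kappa> x \<xi> \<partial>M) powr p) \<partial>M)"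
    by (intro nn_integral_cong arg_cong[where f = "\<lambda>z. ennreal (cmod z powr p)"] Bochner_Integration.integral_cong)
      (simp_all add: \<kappa>)
  also have "\<dots> \<le> ennreal C * (\<integral>\<^sup>+x. ennreal (cmod (f (T x)) powr p * w x) \<partial>M)"
    by (rule paley_ineqD[OF P fT])
  also have "(\<integral>\<^sup>+x. ennreal (cmod (f (T x)) powr p * w x) \<partial>M) = (\<integral>\<^sup>+x. ennreal (cmod (f (T x)) powr p * w' (T x)) \<partial>M)"
    by (intro nn_integral_cong) (simp add: w)
  also have "\<dots> = (\<integral>\<^sup>+x. ennreal (cmod (f x) powr p * w' x) \<partial>distr M N T)"
    by (intro nn_integral_distr[symmetric]) auto
  finally show "(\<integral>\<^sup>+\<xi>. ennreal (cmod (\<integral>x. f x * \<kappa>' x \<xi> \<partial>distr M N T) powr p) \<partial>distr M N T)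
    \<le> ennreal C * (\<integral>\<^sup>+x. ennreal (cmod (f x) powr p * w' x) \<partial>distr M N T)" .
qed

text \<open>Evaluating both measures on a set amounts to integrating its indicator, for which the
  iterated integral over the added coordinate and the old ones is available.\<close>

lemma (in product_sigma_finite) distr_pair_PiM_insert:
  assumes "finite I" "i \<notin> I"
  shows "distr (M i \<Otimes>\<^sub>M Pi\<^sub>M I M) (Pi\<^sub>M (insert i I) M) (\<lambda>z. (snd z)(i := fst z)) = Pi\<^sub>M (insert i I) M"
    (is "distr ?P ?Q ?T = _")
proof (rule measure_eqI)
  interpret I: finite_product_sigma_finite M I by standard (fact assms(1))
  interpret P: pair_sigma_finite "M i" "Pi\<^sub>M I M" ..
  have T [measurable]: "?T \<in> measurable ?P ?Q"
    by (rule measurable_fun_upd[where J = I]) (auto simp: assms)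
  fix A assume "A \<in> sets (distr ?P ?Q ?T)"
  then have [measurable]: "A \<in> sets ?Q" by simp
  have "emeasure (distr ?P ?Q ?T) A = (\<integral>\<^sup>+x. indicator A x \<partial>distr ?P ?Q ?T)"
    by (intro nn_integral_indicator[symmetric]) simp
  also have "\<dots> = (\<integral>\<^sup>+z. indicator A (?T z) \<partial>?P)"
    by (intro nn_integral_distr) auto
  also have "\<dots> = (\<integral>\<^sup>+y. \<integral>\<^sup>+x. indicator A (x(i := y)) \<partial>Pi\<^sub>M I M \<partial>M i)"
    by (subst I.nn_integral_fst[symmetric]) auto
  also have "\<dots> = (\<integral>\<^sup>+x. indicator A x \<partial>?Q)"
    by (intro product_nn_integral_insert_rev[symmetric] assms) auto
  finally show "emeasure (distr ?P ?Q ?T) A = emeasure ?Q A" by simp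
qed simp

lemma paley_ineq_PiM:
  fixes I :: "'i set"
  assumes P: "paley_ineq lborel fourier_kernel (\<lambda>x. \<bar>x\<bar> powr (p - 2)) p C" and C: "C \<ge> 0" and I: "finite I"
  shows "paley_ineq (Pi\<^sub>M I (\<lambda>_. lborel)) (\<lambda>x \<xi>. \<Prod>k\<in>I. fourier_kernel (x k) (\<xi> k))
    (\<lambda>x. \<Prod>k\<in>I. \<bar>x k\<bar> powr (p - 2)) p (C ^ card I)"
  using I
proof (induction I rule: finite_induct)
  \<comment> \<open>The empty product is a single point of mass 1: kernel, weight and constant are
    all 1, and both sides equal |f|^p at that point.\<close>
  case empty
  show ?case
    by (auto simp: paley_ineq_def PiM_empty nn_integral_count_space_finite lebesgue_integral_count_space_finite)
next
  case (insert i I)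
  interpret product_sigma_finite "\<lambda>_ :: 'i. lborel :: real measure" ..
  interpret I: finite_product_sigma_finite "\<lambda>_ :: 'i. lborel :: real measure" I by standard (fact insert.hyps)
  interpret pair_sigma_finite "lborel :: real measure" "Pi\<^sub>M I (\<lambda>_. lborel :: real measure)" ..
  have meas: "(\<lambda>z. \<Prod>k\<in>J. fourier_kernel (fst z k) (snd z k)) \<in>
      borel_measurable (Pi\<^sub>M J (\<lambda>_. lborel) \<Otimes>\<^sub>M Pi\<^sub>M J (\<lambda>_. lborel))" for J :: "'i set"
  proof (intro borel_measurable_prod)
    fix k assume "k \<in> J"
    then have [measurable]: "(\<lambda>x. x k) \<in> measurable (Pi\<^sub>M J (\<lambda>_. lborel :: real measure)) borel"
      using measurable_component_singleton[of k J "\<lambda>_. lborel :: real measure"] by simp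
    show "(\<lambda>z. fourier_kernel (fst z k) (snd z k)) \<in> borel_measurable (Pi\<^sub>M J (\<lambda>_. lborel) \<Otimes>\<^sub>M Pi\<^sub>M J (\<lambda>_. lborel))"
      unfolding fourier_kernel_def by measurable
  qed
  have meas_w: "(\<lambda>x. \<Prod>k\<in>J. \<bar>x k\<bar> powr (p - 2)) \<in> borel_measurable (Pi\<^sub>M J (\<lambda>_. lborel))" for J :: "'i set"
  proof (intro borel_measurable_prod)
    fix k assume "k \<in> J"
    then have [measurable]: "(\<lambda>x. x k) \<in> measurable (Pi\<^sub>M J (\<lambda>_. lborel :: real measure)) borel"
      using measurable_component_singleton[of k J "\<lambda>_. lborel :: real measure"] by simp
    show "(\<lambda>x. \<bar>x k\<bar> powr (p - 2)) \<in> borel_measurable (Pi\<^sub>M J (\<lambda>_. lborel))" by measurable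
  qed
  have pair: "paley_ineq (lborel \<Otimes>\<^sub>M Pi\<^sub>M I (\<lambda>_. lborel))
      (\<lambda>z \<zeta>. fourier_kernel (fst z) (fst \<zeta>) * (\<Prod>k\<in>I. fourier_kernel (snd z k) (snd \<zeta> k)))
      (\<lambda>z. \<bar>fst z\<bar> powr (p - 2) * (\<Prod>k\<in>I. \<bar>snd z k\<bar> powr (p - 2))) p (C * C ^ card I)"
    using C meas[of I] meas_w[of I] measurable_fourier_kernel
    by (intro paley_ineq_pair P insert.IH lborel.sigma_finite_measure_axioms I.sigma_finite_measure_axioms)
      (auto simp: prod_norm[symmetric] prod_nonneg)
  \<comment> \<open>Stated for any two-argument factor with values in a commutative monoid, so that
    it covers the complex kernel and, with a dummy second argument, the real weight.\<close>
  have upd: "(\<Prod>k\<in>insert i I. g ((y(i := x)) k) ((y'(i := x')) k)) = g x x' * (\<Prod>k\<in>I. g (y k) (y' k))"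
    for g :: "real \<Rightarrow> real \<Rightarrow> 'b::comm_monoid_mult" and x x' y y'
    using insert.hyps by (auto intro!: arg_cong2[where f = "(*)"] prod.cong)
  have "paley_ineq (distr (lborel \<Otimes>\<^sub>M Pi\<^sub>M I (\<lambda>_. lborel)) (Pi\<^sub>M (insert i I) (\<lambda>_. lborel)) (\<lambda>z. (snd z)(i := fst z)))
      (\<lambda>x \<xi>. \<Prod>k\<in>insert i I. fourier_kernel (x k) (\<xi> k)) (\<lambda>x. \<Prod>k\<in>insert i I. \<bar>x k\<bar> powr (p - 2)) p (C * C ^ card I)"
  proof (rule paley_ineq_distr[OF sigma_finite_measure_axioms pair])
    show "(\<lambda>z. (snd z)(i := fst z)) \<in> measurable (lborel \<Otimes>\<^sub>M Pi\<^sub>M I (\<lambda>_. lborel)) (Pi\<^sub>M (insert i I) (\<lambda>_. lborel))"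
      by (rule measurable_fun_upd[where J = I]) auto
  qed (use meas meas_w upd[of fourier_kernel] upd[of "\<lambda>x _. \<bar>x\<bar> powr (p - 2)"] in auto)
  then show ?case
    using insert.hyps by (simp add: distr_pair_PiM_insert)
qed

text \<open>Lebesgue measure is the image of the product measure under the map from coordinates to
  vectors. This map turns the inner product into a sum over coordinates, so the exponential becomes
  the product of the one-dimensional kernels.\<close>

lemma paley_ineq_euclidean:
  assumes P: "paley_ineq lborel fourier_kernel (\<lambda>x. \<bar>x\<bar> powr (p - 2)) p C" and C: "C \<ge> 0"
  shows "paley_ineq (lborel :: 'a::euclidean_space measure) (\<lambda>x \<xi>. cis (- 2 * pi * (x \<bullet> \<xi>)))
    (\<lambda>x. \<Prod>b\<in>Basis. \<bar>x \<bullet> b\<bar> powr (p - 2)) p (C ^ DIM('a))"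
proof -
  interpret finite_product_sigma_finite "\<lambda>_ :: 'a. lborel :: real measure" Basis by standard simp
  have cis_sum: "cis (\<Sum>k\<in>A. g k) = (\<Prod>k\<in>A. cis (g k))" for g and A :: "'a set"
    by (induction A rule: infinite_finite_induct) (auto simp: cis_mult[symmetric])
  have "paley_ineq (distr (\<Pi>\<^sub>M b\<in>Basis. lborel) (borel :: 'a measure) (\<lambda>f. \<Sum>b\<in>Basis. f b *\<^sub>R b))
     (\<lambda>x \<xi>. cis (- 2 * pi * (x \<bullet> \<xi>))) (\<lambda>x. \<Prod>b\<in>Basis. \<bar>x \<bullet> b\<bar> powr (p - 2)) p (C ^ DIM('a))"
  proof (rule paley_ineq_distr[OF sigma_finite_measure_axioms paley_ineq_PiM[OF P C finite_Basis]])
    fix x \<xi> :: "'a \<Rightarrow> real"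
    have "(\<Sum>b\<in>Basis. x b *\<^sub>R b) \<bullet> (\<Sum>b\<in>Basis. \<xi> b *\<^sub>R b) = (\<Sum>b\<in>Basis. x b * \<xi> b)"
      by (subst euclidean_inner) simp
    then show "cis (- 2 * pi * ((\<Sum>b\<in>Basis. x b *\<^sub>R b) \<bullet> (\<Sum>b\<in>Basis. \<xi> b *\<^sub>R b))) = (\<Prod>k\<in>Basis. fourier_kernel (x k) (\<xi> k))"
      by (simp only: fourier_kernel_def cis_sum[symmetric] sum_distrib_left)
  qed auto
  then show ?thesis by (simp add: lborel_eq[where 'a = 'a, symmetric])
qed

section \<open>From Borel to Lebesgue measurable functions\<close>

text \<open>The estimates so far concern \<open>lborel\<close>, where Fubini is applied to products,
  while the theorem speaks of its completion. Borel versions of real and imaginary part change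
  \<open>f\<close> on a null set only.\<close>

lemma integrable_lebesgue_ex_lborel:
  fixes f :: "'a::euclidean_space \<Rightarrow> complex"
  assumes f: "integrable lebesgue f"
  obtains g where "integrable lborel g" "AE x in lborel. f x = g x"
proof -
  have [measurable]: "f \<in> borel_measurable lebesgue" using f by simp
  have "(\<lambda>x. Re (f x)) \<in> borel_measurable lebesgue" "(\<lambda>x. Im (f x)) \<in> borel_measurable lebesgue" by measurable
  from this[THEN completion_ex_borel_measurable_real] obtain r i where
    [measurable]: "r \<in> borel_measurable lborel" "i \<in> borel_measurable lborel" and
    ae: "AE x in lborel. Re (f x) = r x" "AE x in lborel. Im (f x) = i x"
    by blast
  define g where "g x = Complex (r x) (i x)" for x
  have g_eq: "g x = complex_of_real (r x) + \<i> * complex_of_real (i x)" for x by (simp add: g_def Complex_eq)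
  have [measurable]: "g \<in> borel_measurable borel" unfolding g_eq[abs_def] by measurable
  have eq: "AE x in lborel. f x = g x"
    using ae by eventually_elim (simp add: g_def complex_eq_iff)
  have [measurable]: "g \<in> borel_measurable lebesgue" by (rule measurable_completion) simp
  have "integrable lebesgue g"
    using f by (rule integrable_cong_AE_imp) (use eq in \<open>auto intro: AE_completion\<close>)
  then have "integrable lborel g" by (subst (asm) integrable_completion) auto
  with eq show ?thesis by (rule that[rotated])
qed

theorem theorem1p8:
  fixes p :: real
  assumes "2 \<le> p"
  shows "\<exists>C::real. C > 0 \<and>
    (\<forall>f :: real ^ 'n \<Rightarrow> complex. integrable lebesgue f \<longrightarrow>
      (\<integral>\<^sup>+ \<xi>. ennreal (cmod (fourier_transform f \<xi>) powr p) \<partial>lebesgue)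
        \<le> ennreal C *
          (\<integral>\<^sup>+ x. ennreal (cmod (f x) powr p * (\<Prod>k\<in>UNIV. \<bar>x $ k\<bar>) powr (p - 2)) \<partial>lebesgue))"
proof -
  obtain C where C: "C > 0" "paley_ineq lborel fourier_kernel (\<lambda>x. \<bar>x\<bar> powr (p - 2)) p C"
    using hardy_littlewood_1d[OF assms] unfolding paley_ineq_def by blast
  let ?d = "DIM(real ^ 'n)"
  have weight: "(\<Prod>b\<in>Basis. \<bar>x \<bullet> b\<bar> powr (p - 2)) = (\<Prod>k\<in>UNIV. \<bar>x $ k\<bar>) powr (p - 2)" for x :: "real ^ 'n"
  proof -
    have B: "(Basis :: (real ^ 'n) set) = range (\<lambda>k. axis k 1)" by (auto simp: Basis_vec_def)
    have "inj (\<lambda>k :: 'n. axis k (1 :: real))" by (auto simp: inj_def axis_eq_axis)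
    then show ?thesis
      unfolding B by (subst prod.reindex) (auto simp: inner_axis prod_powr_distrib)
  qed
  have "(\<integral>\<^sup>+ \<xi>. ennreal (cmod (fourier_transform f \<xi>) powr p) \<partial>lebesgue)
        \<le> ennreal (C ^ ?d) *
          (\<integral>\<^sup>+ x. ennreal (cmod (f x) powr p * (\<Prod>k\<in>UNIV. \<bar>x $ k\<bar>) powr (p - 2)) \<partial>lebesgue)"
    if f: "integrable lebesgue f" for f :: "real ^ 'n \<Rightarrow> complex"
  proof -
    obtain g where g: "integrable lborel g" and eq: "AE x in lborel. f x = g x"
      using integrable_lebesgue_ex_lborel[OF f] .
    have [measurable]: "f \<in> borel_measurable lebesgue" using f by simp
    have [measurable]: "g \<in> borel_measurable borel" using g by auto
    have [measurable]: "g \<in> borel_measurable lebesgue" by (rule measurable_completion) simp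
    have kernel: "exp (- 2 * complex_of_real pi * \<i> * complex_of_real t) = cis (- 2 * pi * t)" for t
      by (simp add: cis_conv_exp mult_ac)
    \<comment> \<open>An equality at every frequency, not just almost everywhere, since changing
      \<open>f\<close> on a null set leaves each integral unchanged. Thus the left side of the
      theorem can be rewritten outright.\<close>
    have ft: "fourier_transform f \<xi> = (\<integral>x. g x * cis (- 2 * pi * (x \<bullet> \<xi>)) \<partial>lborel)" for \<xi>
    proof -
      have [measurable]: "(\<lambda>x. cis (- 2 * pi * (x \<bullet> \<xi>))) \<in> borel_measurable borel" by measurable
      then have [measurable]: "(\<lambda>x. cis (- 2 * pi * (x \<bullet> \<xi>))) \<in> borel_measurable lebesgue"
        by (intro measurable_completion) simp
      have "fourier_transform f \<xi> = (\<integral>x. g x * cis (- 2 * pi * (x \<bullet> \<xi>)) \<partial>lebesgue)"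
        unfolding fourier_transform_def kernel
      proof (rule integral_cong_AE)
        have "AE x in lebesgue. f x = g x" using eq by (rule AE_completion)
        then show "AE x in lebesgue. f x * cis (- 2 * pi * (x \<bullet> \<xi>)) = g x * cis (- 2 * pi * (x \<bullet> \<xi>))"
          by eventually_elim simp
      qed measurable
      also have "\<dots> = (\<integral>x. g x * cis (- 2 * pi * (x \<bullet> \<xi>)) \<partial>lborel)"
        by (rule integral_completion) measurable
      finally show ?thesis .
    qed
    have "(\<integral>\<^sup>+ \<xi>. ennreal (cmod (fourier_transform f \<xi>) powr p) \<partial>lebesgue)
      \<le> ennreal (C ^ ?d) * (\<integral>\<^sup>+x. ennreal (cmod (g x) powr p * (\<Prod>k\<in>UNIV. \<bar>x $ k\<bar>) powr (p - 2)) \<partial>lborel)"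
      using paley_ineqD[OF paley_ineq_euclidean[OF C(2)] g] C(1)
      unfolding nn_integral_completion ft weight by simp
    also have "(\<integral>\<^sup>+x. ennreal (cmod (g x) powr p * (\<Prod>k\<in>UNIV. \<bar>x $ k\<bar>) powr (p - 2)) \<partial>lborel)
      = (\<integral>\<^sup>+x. ennreal (cmod (f x) powr p * (\<Prod>k\<in>UNIV. \<bar>x $ k\<bar>) powr (p - 2)) \<partial>lborel)"
      by (intro nn_integral_cong_AE) (use eq in eventually_elim, simp)
    finally show ?thesis unfolding nn_integral_completion .
  qed
  then show ?thesis using C(1) by (intro exI[of _ "C ^ ?d"]) auto
qed

end
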